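(* For all integers $2\le m\le n$, the ideal $J_2(m,n)$ of relations between the $2$-minors of a generic $m\times n$ matrix has no minimal generators of degree $4$, i.e. $(J_2)_4=(S_2)_1\cdot (J_2)_3$.
   Context: $\Bbbk$ is a field of characteristic $0$; $V,W$ are $\Bbbk$-vector spaces of dimensions $m,n$. $X$ is an $m\times n$ matrix of indeterminates over $\Bbbk$, $A_2$ is the subalgebra of $\Bbbk[X]$ generated by the $2$-minors of $X$, graded so that $2$-minors have degree $1$; $S_2=\mathrm{Sym}(\bigwedge^2V\otimes\bigwedge^2W^* )$ is the polynomial ring with one variable for each $2$-minor, $\pi:S_2\to A_2$ is the graded surjection sending each variable (basis vector $(e_{i}\wedge e_{j})\otimes(f_p^*\wedge f_q^* )$, where $e_1,\dots,e_m$ is a basis of $V$ and $f_1^*,\dots,f_n^*$ is the dual basis of a basis $f_1,\dots,f_n$ of $W$) to the corresponding minor, and $J_2=J_2(m,n)=\ker\pi$. *)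

theory Defs
  imports Complex_Main "HOL-Library.Poly_Mapping"
begin

section \<open>Polynomials over a field in an arbitrary set of variables\<close>

text \<open>
  A monomial with variables from \<open>'x\<close> is a finitely supported exponent vector, and a polynomial is a
  finitely supported function from monomials to coefficients; the ring operations on
  \<open>('x \<Rightarrow>\<^sub>0 nat) \<Rightarrow>\<^sub>0 'k\<close> are those of the monoid algebra.
\<close>

type_synonym ('x, 'k) mpoly = "('x \<Rightarrow>\<^sub>0 nat) \<Rightarrow>\<^sub>0 'k"

definition Var :: "'x \<Rightarrow> ('x, 'k::comm_ring_1) mpoly" where
  "Var x = Poly_Mapping.single (Poly_Mapping.single x 1) 1"

definition Const :: "'k::comm_ring_1 \<Rightarrow> ('x, 'k) mpoly" where
  "Const c = Poly_Mapping.single 0 c"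

definition poly_ring :: "'x set \<Rightarrow> ('x, 'k::comm_ring_1) mpoly set" where
  "poly_ring Xs = {p. \<forall>t \<in> Poly_Mapping.keys p. Poly_Mapping.keys t \<subseteq> Xs}"

definition mon_degree :: "('x \<Rightarrow>\<^sub>0 nat) \<Rightarrow> nat" where
  "mon_degree t = (\<Sum>x \<in> Poly_Mapping.keys t. Poly_Mapping.lookup t x)"

definition homogeneous :: "nat \<Rightarrow> ('x, 'k::comm_ring_1) mpoly set" where
  "homogeneous d = {p. \<forall>t \<in> Poly_Mapping.keys p. mon_degree t = d}"

definition mon_subst :: "('x \<Rightarrow> ('y, 'k::comm_ring_1) mpoly) \<Rightarrow> ('x \<Rightarrow>\<^sub>0 nat) \<Rightarrow> ('y, 'k) mpoly" where
  "mon_subst f t = (\<Prod>x \<in> Poly_Mapping.keys t. f x ^ Poly_Mapping.lookup t x)"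

definition subst :: "('x \<Rightarrow> ('y, 'k::comm_ring_1) mpoly) \<Rightarrow> ('x, 'k) mpoly \<Rightarrow> ('y, 'k) mpoly" where
  "subst f p = (\<Sum>t \<in> Poly_Mapping.keys p. Const (Poly_Mapping.lookup p t) * mon_subst f t)"

definition is_subalgebra :: "('x, 'k::comm_ring_1) mpoly set \<Rightarrow> bool" where
  "is_subalgebra B \<longleftrightarrow> (\<forall>c. Const c \<in> B) \<and> (\<forall>p\<in>B. \<forall>q\<in>B. p + q \<in> B \<and> p * q \<in> B)"

lemma Const_0 [simp]: "Const 0 = 0"
  and Const_1 [simp]: "Const 1 = 1"
  and Const_add: "Const (a + b) = Const a + Const b"
  and Const_mult: "Const (a * b) = Const a * Const b"
  by (simp_all add: Const_def single_add mult_single)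

global_interpretation mpoly: vector_space "\<lambda>(c :: 'k::field) (p :: ('x, 'k) mpoly). Const c * p"
  by unfold_locales (simp_all add: Const_add Const_mult algebra_simps)

text \<open>The product \<open>A \<cdot> B\<close> of two subspaces: all linear combinations of products \<open>a * b\<close>.\<close>

definition space_prod ::
    "('x, 'k::field) mpoly set \<Rightarrow> ('x, 'k) mpoly set \<Rightarrow> ('x, 'k) mpoly set" (infixl \<open>\<cdot>\<close> 70) where
  "A \<cdot> B = mpoly.span {a * b | a b. a \<in> A \<and> b \<in> B}"


section \<open>Relations between the 2-minors of a generic matrix\<close>

text \<open>
  The indeterminate \<open>X\<^sub>i\<^sub>p\<close> is \<open>Var (i, p)\<close>. A pair \<open>((i, j), (p, q))\<close> with \<open>i < j\<close>, \<open>p < q\<close> indexes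
  both the 2-minor with rows \<open>i, j\<close> and columns \<open>p, q\<close>, and the basis vector
  \<open>(e\<^sub>i \<and> e\<^sub>j) \<otimes> (f\<^sub>p\<^sup>* \<and> f\<^sub>q\<^sup>*)\<close>, that is, the corresponding variable of \<open>S\<^sub>2\<close>.
\<close>

type_synonym minor_idx = "(nat \<times> nat) \<times> (nat \<times> nat)"

definition minor_indices :: "nat \<Rightarrow> nat \<Rightarrow> minor_idx set" where
  "minor_indices m n =
     {((i, j), (p, q)) | i j p q. 1 \<le> i \<and> i < j \<and> j \<le> m \<and> 1 \<le> p \<and> p < q \<and> q \<le> n}"

fun minor2 :: "minor_idx \<Rightarrow> (nat \<times> nat, 'k::comm_ring_1) mpoly" where
  "minor2 ((i, j), (p, q)) = Var (i, p) * Var (j, q) - Var (i, q) * Var (j, p)"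

definition A2 :: "nat \<Rightarrow> nat \<Rightarrow> (nat \<times> nat, 'k::field) mpoly set" where
  "A2 m n = is_subalgebra hull (minor2 ` minor_indices m n)"

definition S2 :: "nat \<Rightarrow> nat \<Rightarrow> (minor_idx, 'k::field) mpoly set" where
  "S2 m n = poly_ring (minor_indices m n)"

definition minor_map :: "(minor_idx, 'k::field) mpoly \<Rightarrow> (nat \<times> nat, 'k) mpoly" where
  "minor_map = subst minor2"

definition J2 :: "nat \<Rightarrow> nat \<Rightarrow> (minor_idx, 'k::field) mpoly set" where
  "J2 m n = {s \<in> S2 m n. minor_map s = 0}"


section \<open>\<open>minor_map\<close> is an algebra homomorphism from \<open>S2 m n\<close> onto \<open>A2 m n\<close>\<close>

lemma mon_subst_superset:
  assumes "finite F" "Poly_Mapping.keys t \<subseteq> F"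
  shows "mon_subst f t = (\<Prod>x \<in> F. f x ^ Poly_Mapping.lookup t x)"
  unfolding mon_subst_def
  by (rule prod.mono_neutral_left) (use assms in \<open>auto simp: in_keys_iff\<close>)

lemma mon_subst_0 [simp]: "mon_subst f 0 = 1"
  by (simp add: mon_subst_def)

lemma mon_subst_add: "mon_subst f (s + t) = mon_subst f s * mon_subst f t"
proof -
  let ?F = "Poly_Mapping.keys s \<union> Poly_Mapping.keys t"
  have "Poly_Mapping.keys (s + t) \<subseteq> ?F" by (rule keys_add)
  then show ?thesis
    by (simp add: mon_subst_superset[of ?F] lookup_add power_add prod.distrib)
qed

lemma subst_superset:
  assumes "finite F" "Poly_Mapping.keys p \<subseteq> F"
  shows "subst f p = (\<Sum>t \<in> F. Const (Poly_Mapping.lookup p t) * mon_subst f t)"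
  unfolding subst_def
  by (rule sum.mono_neutral_left) (use assms in \<open>auto simp: in_keys_iff\<close>)

lemma subst_add: "subst f (p + q) = subst f p + subst f q"
proof -
  let ?F = "Poly_Mapping.keys p \<union> Poly_Mapping.keys q"
  have "Poly_Mapping.keys (p + q) \<subseteq> ?F" by (rule keys_add)
  then show ?thesis
    by (simp add: subst_superset[of ?F] lookup_add Const_add algebra_simps sum.distrib)
qed

lemma subst_single: "subst f (Poly_Mapping.single t c) = Const c * mon_subst f t"
  by (simp add: subst_def)

lemma subst_0 [simp]: "subst f 0 = 0"
  by (simp add: subst_def)

lemma subst_Const: "subst f (Const c) = Const c"
  using subst_single[of f 0 c] by (simp add: Const_def)

lemma subst_Var: "subst f (Var x) = f x"
  by (simp add: Var_def subst_single) (simp add: mon_subst_def)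

lemma mpoly_induct [case_names zero term_add]:
  fixes p :: "('x, 'k::comm_ring_1) mpoly"
  assumes "P 0" and "\<And>t c p. P p \<Longrightarrow> P (Poly_Mapping.single t c + p)"
  shows "P p"
proof (induction p rule: update_induct)
  case (update p t c)
  have "Poly_Mapping.update t c p = Poly_Mapping.single t c + p"
    using update(1)
    by (intro poly_mapping_eqI) (auto simp: lookup_update lookup_add lookup_single in_keys_iff)
  with update assms(2) show ?case by simp
qed (rule assms(1))

lemma subst_mult: "subst f (p * q) = subst f p * subst f q"
proof (induction p rule: mpoly_induct)
  case (term_add t c p)
  have "subst f (Poly_Mapping.single t c * q) = subst f (Poly_Mapping.single t c) * subst f q"
    by (induction q rule: mpoly_induct)
      (simp_all add: subst_add subst_single mult_single mon_subst_add Const_mult algebra_simps)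
  with term_add show ?case
    by (simp add: subst_add algebra_simps)
qed simp

lemma is_subalgebra_sum: "is_subalgebra B \<Longrightarrow> (\<And>x. x \<in> F \<Longrightarrow> g x \<in> B) \<Longrightarrow> sum g F \<in> B"
  and is_subalgebra_prod: "is_subalgebra B \<Longrightarrow> (\<And>x. x \<in> F \<Longrightarrow> g x \<in> B) \<Longrightarrow> prod g F \<in> B"
  and is_subalgebra_power: "is_subalgebra B \<Longrightarrow> p \<in> B \<Longrightarrow> p ^ k \<in> B"
proof -
  assume B: "is_subalgebra B"
  then have 01: "0 \<in> B" "1 \<in> B"
    unfolding is_subalgebra_def by (metis Const_0, metis Const_1)
  show "sum g F \<in> B" if "\<And>x. x \<in> F \<Longrightarrow> g x \<in> B"
    using that B 01 by (induction F rule: infinite_finite_induct) (auto simp: is_subalgebra_def)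
  show "prod g F \<in> B" if "\<And>x. x \<in> F \<Longrightarrow> g x \<in> B"
    using that B 01 by (induction F rule: infinite_finite_induct) (auto simp: is_subalgebra_def)
  show "p ^ k \<in> B" if "p \<in> B"
    using that B 01 by (induction k) (auto simp: is_subalgebra_def)
qed

lemma is_subalgebra_poly_ring: "is_subalgebra (poly_ring Xs)"
  unfolding is_subalgebra_def
proof (intro conjI ballI allI)
  show "Const c \<in> poly_ring Xs" for c
    by (simp add: poly_ring_def Const_def)
  fix p q :: "('a, 'b) mpoly" assume pq: "p \<in> poly_ring Xs" "q \<in> poly_ring Xs"
  then show "p + q \<in> poly_ring Xs"
    using keys_add[of p q] by (force simp: poly_ring_def)
  show "p * q \<in> poly_ring Xs"
    unfolding poly_ring_def
  proof (intro CollectI ballI)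
    fix t assume "t \<in> Poly_Mapping.keys (p * q)"
    then obtain a b where "t = a + b" "a \<in> Poly_Mapping.keys p" "b \<in> Poly_Mapping.keys q"
      using keys_mult[of p q] by blast
    then show "Poly_Mapping.keys t \<subseteq> Xs"
      using pq keys_add[of a b] by (force simp: poly_ring_def)
  qed
qed

lemma minor_map_image: "minor_map ` S2 m n = (A2 m n :: (nat \<times> nat, 'k::field) mpoly set)"
proof
  show "minor_map ` S2 m n \<subseteq> (A2 m n :: (nat \<times> nat, 'k::field) mpoly set)"
    unfolding A2_def hull_def
  proof (intro subsetI InterI)
    fix p :: "(nat \<times> nat, 'k) mpoly" and B :: "(nat \<times> nat, 'k) mpoly set"
    assume "p \<in> minor_map ` S2 m n"
      and "B \<in> {B. is_subalgebra B \<and> minor2 ` minor_indices m n \<subseteq> B}"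
    then obtain s where s: "s \<in> S2 m n" "p = minor_map s"
      and B: "is_subalgebra B" "minor2 ` minor_indices m n \<subseteq> B" by blast
    have "mon_subst minor2 t \<in> B" if "t \<in> Poly_Mapping.keys s" for t
      unfolding mon_subst_def using that s(1) B
      by (intro is_subalgebra_prod is_subalgebra_power) (auto simp: S2_def poly_ring_def)
    then have "Const (Poly_Mapping.lookup s t) * mon_subst minor2 t \<in> B"
      if "t \<in> Poly_Mapping.keys s" for t
      using that B(1) unfolding is_subalgebra_def by blast
    then show "p \<in> B"
      unfolding s(2) minor_map_def subst_def by (intro is_subalgebra_sum[OF B(1)])
  qed
  show "A2 m n \<subseteq> (minor_map ` S2 m n :: (nat \<times> nat, 'k::field) mpoly set)"
    unfolding A2_def
  proof (rule hull_minimal)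
    show "minor2 ` minor_indices m n \<subseteq> (minor_map ` S2 m n :: (nat \<times> nat, 'k) mpoly set)"
    proof (intro subsetI, elim imageE)
      fix p :: "(nat \<times> nat, 'k) mpoly" and x
      assume x: "p = minor2 x" "x \<in> minor_indices m n"
      have "Var x \<in> (S2 m n :: (minor_idx, 'k) mpoly set)"
        using x(2) by (simp add: S2_def poly_ring_def Var_def)
      then show "p \<in> minor_map ` S2 m n"
        by (rule rev_image_eqI) (simp add: x(1) minor_map_def subst_Var)
    qed
    have S: "is_subalgebra (S2 m n :: (minor_idx, 'k) mpoly set)"
      by (simp add: S2_def is_subalgebra_poly_ring)
    show "is_subalgebra (minor_map ` S2 m n :: (nat \<times> nat, 'k) mpoly set)"
      unfolding is_subalgebra_def
    proof (intro conjI ballI allI)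
      show "Const c \<in> (minor_map ` S2 m n :: (nat \<times> nat, 'k) mpoly set)" for c
        by (rule image_eqI[of _ _ "Const c"])
          (use S in \<open>auto simp: minor_map_def subst_Const is_subalgebra_def\<close>)
    next
      fix p q :: "(nat \<times> nat, 'k) mpoly"
      assume "p \<in> minor_map ` S2 m n" "q \<in> minor_map ` S2 m n"
      then obtain s t where st: "s \<in> S2 m n" "p = minor_map s" "t \<in> S2 m n" "q = minor_map t"
        by blast
      show "p + q \<in> minor_map ` S2 m n"
        by (rule image_eqI[of _ _ "s + t"])
          (use S st in \<open>auto simp: minor_map_def subst_add is_subalgebra_def\<close>)
      show "p * q \<in> minor_map ` S2 m n"
        by (rule image_eqI[of _ _ "s * t"])
          (use S st in \<open>auto simp: minor_map_def subst_mult is_subalgebra_def\<close>)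
    qed
  qed
qed

end

theory Submission
  imports Defs "HOL-Library.FuncSet" "HOL-Combinatorics.Permutations"
begin

text \<open>
  In characteristic 0, polarization reduces the claim to relations that are multilinear in eight rows,
  and a projection onto the relations that is equivariant under permutations of the eight rows
  (obtained by averaging) reduces it further to relations that are antisymmetric under the exchanges
  of partner rows \<open>1 \<leftrightarrow> 2\<close>, \<open>3 \<leftrightarrow> 4\<close>, \<open>5 \<leftrightarrow> 6\<close>, \<open>7 \<leftrightarrow> 8\<close>. Up to such exchanges, a product of
  four minors is a 2-regular multigraph: its vertices are the four pairs of partners, and each
  minor is an edge joining the pairs of its two rows. Modulo products of linear forms with cubic
  relations, every such graph reduces to the one with four loops. Cycles of length 2 and 3 are
  removed by a relation of degree 2 and 3. In a 4-cycle, a quadratic relation shows that the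
  exchange of the columns of adjacent edges changes the sign, while two applications of a cubic
  relation show that the exchange of the columns of opposite edges does not. As the latter exchange
  is a product of three of the former, the 4-cycle equals its negative and vanishes. Finally, the
  products with four loops are sent to linearly independent polynomials.
\<close>

section \<open>Graded pieces and substitutions\<close>

text \<open>Take a path of k edges from row x to row y and antisymmetrize it in x, y and in the
  partners at its k - 1 inner vertices. The monomials of its image become products of minors, one in
  rows x, y and one for each inner pair. This yields a relation of degree k saying that, modulo
  partner antisymmetry and words with more loops, exchanging x and y does not change the path. If x
  and y are partners, the path is a k-cycle and the exchange also has sign -1, so the cycle reduces
  to those words. For k = 2 and k = 3 the relation may be multiplied by linear forms. For k = 4 it
  has degree 4, and calling it decomposable would be circular; hence the separate sign argument,
  built from paths of at most three edges. The projection is needed because a multilinear relation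
  need not be antisymmetric. Row permutations generate all words from antisymmetric ones, so the
  images of the latter under an equivariant projection generate all relations. Characteristic 0
  permits division by 2, by 16 and by the number of permutations.\<close>

lemma homogeneous_0: "0 \<in> homogeneous d"
  and homogeneous_Const: "Const c \<in> homogeneous 0"
  by (auto simp: homogeneous_def Const_def mon_degree_def)

lemma homogeneous_Var: "Var x \<in> homogeneous 1"
  by (simp add: homogeneous_def Var_def mon_degree_def)

lemma mon_degree_superset:
  assumes "finite F" "Poly_Mapping.keys t \<subseteq> F"
  shows "mon_degree t = (\<Sum>x\<in>F. Poly_Mapping.lookup t x)"
  unfolding mon_degree_def
  by (rule sum.mono_neutral_left) (use assms in \<open>auto simp: in_keys_iff\<close>)

lemma mon_degree_add: "mon_degree (s + t) = mon_degree s + mon_degree t"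
proof -
  let ?F = "Poly_Mapping.keys s \<union> Poly_Mapping.keys t"
  have "Poly_Mapping.keys (s + t) \<subseteq> ?F" by (rule keys_add)
  then show ?thesis
    by (simp add: mon_degree_superset[of ?F] lookup_add sum.distrib)
qed

lemma homogeneous_add: "p \<in> homogeneous d \<Longrightarrow> q \<in> homogeneous d \<Longrightarrow> p + q \<in> homogeneous d"
  using keys_add[of p q] by (force simp: homogeneous_def)

lemma homogeneous_mult:
  assumes "p \<in> homogeneous d" "q \<in> homogeneous e"
  shows "p * q \<in> homogeneous (d + e)"
  unfolding homogeneous_def
proof (intro CollectI ballI)
  fix t assume "t \<in> Poly_Mapping.keys (p * q)"
  then obtain a b where "t = a + b" "a \<in> Poly_Mapping.keys p" "b \<in> Poly_Mapping.keys q"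
    using keys_mult[of p q] by blast
  then show "mon_degree t = d + e"
    using assms by (simp add: homogeneous_def mon_degree_add)
qed

lemma homogeneous_Const_mult: "p \<in> homogeneous d \<Longrightarrow> Const c * p \<in> homogeneous d"
  using homogeneous_mult[OF homogeneous_Const] by fastforce

lemma homogeneous_sum: "(\<And>x. x \<in> F \<Longrightarrow> g x \<in> homogeneous d) \<Longrightarrow> sum g F \<in> homogeneous d"
  by (induction F rule: infinite_finite_induct) (simp_all add: homogeneous_0 homogeneous_add)

lemma subst_uminus: "subst f (- p) = - subst f p"
  using subst_add[of f p "- p"] by (simp add: eq_neg_iff_add_eq_0 add.commute)

lemma subst_diff: "subst f (p - q) = subst f p - subst f q"
  using subst_add[of f p "- q"] by (simp add: subst_uminus)

lemma subst_sum: "subst f (sum g F) = (\<Sum>x\<in>F. subst f (g x))"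
  by (induction F rule: infinite_finite_induct) (simp_all add: subst_add)

lemma subst_1: "subst f 1 = 1"
  using subst_Const[of f 1] by simp

lemma subst_prod: "subst f (prod g F) = (\<Prod>x\<in>F. subst f (g x))"
  by (induction F rule: infinite_finite_induct) (simp_all add: subst_mult subst_1)

lemma subst_power: "subst f (p ^ k) = subst f p ^ k"
  by (induction k) (simp_all add: subst_mult subst_1)

lemmas subst_simps = subst_add subst_uminus subst_diff subst_sum subst_mult subst_prod subst_Const
  subst_Var

lemma subst_subst: "subst f (subst g p) = subst (\<lambda>x. subst f (g x)) p"
proof (induction p rule: mpoly_induct)
  case (term_add t c p)
  have "subst f (mon_subst g t) = mon_subst (\<lambda>x. subst f (g x)) t"
    by (simp add: mon_subst_def subst_prod subst_power)
  with term_add show ?case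
    by (simp add: subst_add subst_single subst_mult subst_Const)
qed simp

lemma poly_eq_sum:
  "p = (\<Sum>t\<in>Poly_Mapping.keys p. Const (Poly_Mapping.lookup p t) * Poly_Mapping.single t 1)"
  by (rule poly_mapping_eqI)
     (auto simp: lookup_sum Const_def mult_single lookup_single when_def in_keys_iff sum.delta)

lemma subst_in_subalgebra:
  assumes "is_subalgebra B" "\<And>x. x \<in> Xs \<Longrightarrow> f x \<in> B" "p \<in> poly_ring Xs"
  shows "subst f p \<in> B"
proof -
  have "Const (Poly_Mapping.lookup p t) * mon_subst f t \<in> B" if "t \<in> Poly_Mapping.keys p" for t
  proof -
    have "mon_subst f t \<in> B"
      unfolding mon_subst_def using that assms
      by (intro is_subalgebra_prod is_subalgebra_power) (auto simp: poly_ring_def)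
    then show ?thesis using assms(1) by (simp add: is_subalgebra_def)
  qed
  then show ?thesis
    unfolding subst_def by (intro is_subalgebra_sum[OF assms(1)])
qed

lemma subst_homogeneous:
  fixes f :: "'x \<Rightarrow> ('y, 'k::comm_ring_1) mpoly"
  assumes f: "\<And>x. f x \<in> homogeneous 1" and p: "p \<in> homogeneous d"
  shows "subst f p \<in> homogeneous d"
proof -
  have one: "(1 :: ('y, 'k) mpoly) \<in> homogeneous 0"
    using homogeneous_Const[of 1] by simp
  have pow: "f x ^ k \<in> homogeneous k" for x k
    using one homogeneous_mult[OF f] by (induction k) (simp, fastforce)
  have mon: "(\<Prod>x\<in>F. f x ^ g x) \<in> homogeneous (\<Sum>x\<in>F. g x)" if "finite F" for F and g
    using that one by induction (simp_all add: homogeneous_mult[OF pow])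
  have "mon_subst f t \<in> homogeneous d" if "t \<in> Poly_Mapping.keys p" for t
    using mon[of "Poly_Mapping.keys t" "Poly_Mapping.lookup t"] that p
    by (simp add: mon_subst_def homogeneous_def mon_degree_def)
  then show ?thesis
    unfolding subst_def by (intro homogeneous_sum homogeneous_Const_mult)
qed


section \<open>Substitution of rows\<close>

definition skew :: "(nat \<Rightarrow> nat \<Rightarrow> 'a::ab_group_add) \<Rightarrow> nat \<Rightarrow> nat \<Rightarrow> 'a" where
  "skew f x y = (if x < y then f x y else if y < x then - f y x else 0)"

text \<open>The vector \<open>(e\<^sub>i \<and> e\<^sub>j) \<otimes> (f\<^sub>p\<^sup>* \<and> f\<^sub>q\<^sup>*)\<close> for arbitrary indices.\<close>

definition bvar :: "nat \<Rightarrow> nat \<Rightarrow> nat \<Rightarrow> nat \<Rightarrow> (minor_idx, 'k::comm_ring_1) mpoly" where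
  "bvar i j p q = skew (\<lambda>i j. skew (\<lambda>p q. Var ((i, j), (p, q))) p q) i j"

abbreviation xvar :: "nat \<Rightarrow> nat \<Rightarrow> (nat \<times> nat, 'k::comm_ring_1) mpoly" where
  "xvar i p \<equiv> Var (i, p)"

lemma bvar_swap_rows: "bvar j i p q = - bvar i j p q"
  and bvar_swap_cols: "bvar i j q p = - bvar i j p q"
  by (auto simp: bvar_def skew_def)

lemma minor_map_bvar: "minor_map (bvar i j p q) = xvar i p * xvar j q - xvar i q * xvar j p"
  by (auto simp: bvar_def skew_def minor_map_def subst_simps algebra_simps)

text \<open>The action on \<open>S2\<close> of a linear substitution of rows. Sets of rows serve
  both uses: polarization splits a row into several copies, and \<open>row_perm\<close> takes
  singletons.\<close>

definition row_subst ::
    "(nat \<Rightarrow> nat set) \<Rightarrow> (minor_idx, 'k::comm_ring_1) mpoly \<Rightarrow> (minor_idx, 'k) mpoly" where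
  "row_subst c = subst (\<lambda>((i, j), (p, q)). \<Sum>k\<in>c i. \<Sum>l\<in>c j. bvar k l p q)"

lemma row_subst_simps:
  "row_subst c (p + q) = row_subst c p + row_subst c q"
  "row_subst c (p - q) = row_subst c p - row_subst c q"
  "row_subst c (- p) = - row_subst c p"
  "row_subst c (p * q) = row_subst c p * row_subst c q"
  "row_subst c (sum g F) = (\<Sum>x\<in>F. row_subst c (g x))"
  "row_subst c (Const a) = Const a"
  "row_subst c 0 = 0"
  by (simp_all add: row_subst_def subst_simps)

lemma minor_map_simps:
  "minor_map (p + q) = minor_map p + minor_map q"
  "minor_map (p - q) = minor_map p - minor_map q"
  "minor_map (- p) = - minor_map p"
  "minor_map (p * q) = minor_map p * minor_map q"
  "minor_map (sum g F) = (\<Sum>x\<in>F. minor_map (g x))"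
  "minor_map (Const a) = Const a"
  "minor_map 0 = 0"
  by (simp_all add: minor_map_def subst_simps)

text \<open>Functoriality of the second exterior power: a 2-minor of sums of rows is the sum of the
  2-minors of the summands. Hence row substitutions preserve relations.\<close>

lemma minor_map_row_subst:
  "minor_map (row_subst c p) = subst (\<lambda>(i, p). \<Sum>k\<in>c i. xvar k p) (minor_map p)"
proof -
  have *: "subst minor2 (\<Sum>k\<in>c i. \<Sum>l\<in>c j. bvar k l p q :: (minor_idx, 'b::field) mpoly) =
      subst (\<lambda>(i, p). \<Sum>k\<in>c i. xvar k p) (minor2 ((i, j), (p, q)))" for i j p q
    by (simp add: minor_map_bvar[unfolded minor_map_def] subst_simps sum_product sum_subtractf)
  show ?thesis
    unfolding minor_map_def row_subst_def subst_subst by (rule arg_cong2[where f=subst]) (auto simp: * simp del: minor2.simps)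
qed

lemma subalgebra_S2: "is_subalgebra (S2 m n)"
  by (simp add: S2_def is_subalgebra_poly_ring)

lemma S2_Const: "Const c \<in> S2 m n"
  and S2_add: "p \<in> S2 m n \<Longrightarrow> q \<in> S2 m n \<Longrightarrow> p + q \<in> S2 m n"
  and S2_mult: "p \<in> S2 m n \<Longrightarrow> q \<in> S2 m n \<Longrightarrow> p * q \<in> S2 m n"
  by (simp_all add: subalgebra_S2[unfolded is_subalgebra_def])

lemma S2_0: "0 \<in> S2 m n"
  using S2_Const[of 0] by simp

lemmas S2_closed = S2_Const S2_0 S2_add S2_mult

lemma S2_uminus: "p \<in> S2 m n \<Longrightarrow> - p \<in> S2 m n"
  by (simp add: S2_def poly_ring_def)

lemma bvar_S2:
  assumes "i \<in> {1..m}" "j \<in> {1..m}" "p \<in> {1..n}" "q \<in> {1..n}"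
  shows "bvar i j p q \<in> (S2 m n :: (minor_idx, 'k::field) mpoly set)"
proof -
  have "Var x \<in> (S2 m n :: (minor_idx, 'k) mpoly set)" if "x \<in> minor_indices m n" for x :: minor_idx
    using that by (simp add: S2_def poly_ring_def Var_def)
  then show ?thesis
    using assms by (auto simp: bvar_def skew_def minor_indices_def intro!: S2_uminus S2_closed)
qed

lemma homogeneous_uminus: "p \<in> homogeneous d \<Longrightarrow> - p \<in> homogeneous d"
  by (simp add: homogeneous_def)

lemma bvar_homogeneous: "bvar i j p q \<in> homogeneous 1"
  by (auto simp: bvar_def skew_def intro!: homogeneous_uminus homogeneous_Var[simplified] homogeneous_0)

lemma row_subst_S2:
  assumes "\<And>i. i \<in> {1..m} \<Longrightarrow> c i \<subseteq> {1..M}" "p \<in> S2 m n"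
  shows "row_subst c p \<in> S2 M n"
  unfolding row_subst_def
proof (rule subst_in_subalgebra[OF subalgebra_S2])
  show "p \<in> poly_ring (minor_indices m n)" using assms(2) by (simp add: S2_def)
  fix x assume "x \<in> minor_indices m n"
  then show "(\<lambda>((i, j), (p, q)). \<Sum>k\<in>c i. \<Sum>l\<in>c j. bvar k l p q) x \<in> S2 M n"
    using assms(1) unfolding minor_indices_def
    by (auto intro!: is_subalgebra_sum[OF subalgebra_S2] bvar_S2) (metis atLeastAtMost_iff le_trans less_imp_le subsetD)+
qed

lemma row_subst_homogeneous: "p \<in> homogeneous d \<Longrightarrow> row_subst c p \<in> homogeneous d"
  unfolding row_subst_def
  by (rule subst_homogeneous) (auto intro!: homogeneous_sum bvar_homogeneous[simplified])

lemma row_subst_J2: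
  assumes "\<And>i. i \<in> {1..m} \<Longrightarrow> c i \<subseteq> {1..M}" "p \<in> J2 m n"
  shows "row_subst c p \<in> J2 M n"
  using row_subst_S2[OF assms(1), where p = p and n = n] assms(2) by (auto simp: J2_def minor_map_row_subst)

section \<open>Quartic relations that come from cubic ones\<close>

definition decomposable :: "nat \<Rightarrow> nat \<Rightarrow> (minor_idx, 'k::field) mpoly set" where
  "decomposable m n = (S2 m n \<inter> homogeneous 1) \<cdot> (J2 m n \<inter> homogeneous 3)"

lemma subspace_decomposable: "mpoly.subspace (decomposable m n)"
  by (simp add: decomposable_def space_prod_def)

lemma decomposable_mult:
  assumes "a \<in> S2 m n" "a \<in> homogeneous 1" "b \<in> S2 m n" "b \<in> homogeneous 3" "minor_map b = 0"
  shows "a * b \<in> decomposable m n"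
  unfolding decomposable_def space_prod_def
  by (rule mpoly.span_base) (use assms in \<open>auto simp: J2_def\<close>)

lemma subspace_J2: "mpoly.subspace (J2 m n)"
  by (auto simp: mpoly.subspace_def J2_def minor_map_simps intro!: S2_closed)

lemma subspace_homogeneous: "mpoly.subspace (homogeneous d)"
  by (auto simp: mpoly.subspace_def homogeneous_0 homogeneous_add homogeneous_Const_mult)

lemma decomposable_subset: "decomposable m n \<subseteq> J2 m n \<inter> homogeneous 4"
  unfolding decomposable_def space_prod_def
proof (rule mpoly.span_minimal)
  show "mpoly.subspace (J2 m n \<inter> homogeneous 4)"
    by (intro mpoly.subspace_inter subspace_J2 subspace_homogeneous)
  show "{a * b |a b. a \<in> S2 m n \<inter> homogeneous 1 \<and> b \<in> J2 m n \<inter> homogeneous 3}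
      \<subseteq> J2 m n \<inter> homogeneous 4"
    using homogeneous_mult[of _ 1 _ 3] by (fastforce simp: J2_def minor_map_simps intro: S2_closed)
qed

text \<open>Transports decomposability from the eight auxiliary rows back to the original
  ones.\<close>

lemma row_subst_decomposable:
  assumes c: "\<And>i. i \<in> {1..m} \<Longrightarrow> c i \<subseteq> {1..M}" and p: "p \<in> decomposable m n"
  shows "row_subst c p \<in> decomposable M n"
  using p unfolding decomposable_def[of m] space_prod_def
proof (induction rule: mpoly.span_induct)
  case base
  show ?case
    using subspace_decomposable by (auto simp: mpoly.subspace_def row_subst_simps)
next
  case (step x)
  then obtain a b where x: "x = a * b" and "a \<in> S2 m n \<inter> homogeneous 1" "b \<in> J2 m n \<inter> homogeneous 3"
    by blast
  then show ?case
    using row_subst_S2[OF c, where p = a and n = n] row_subst_J2[OF c, where p = b and n = n]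
    by (auto simp: x row_subst_simps J2_def intro!: decomposable_mult row_subst_homogeneous)
qed

section \<open>Exchanges of partner rows\<close>

text \<open>Despite the name, \<sigma> need not be a permutation: restitution merges the new rows
  that copy the same old row, and a minor with two equal rows then becomes 0.\<close>

definition row_perm :: "(nat \<Rightarrow> nat) \<Rightarrow> (minor_idx, 'k::comm_ring_1) mpoly \<Rightarrow> (minor_idx, 'k) mpoly" where
  "row_perm \<sigma> = row_subst (\<lambda>i. {\<sigma> i})"

text \<open>Both sides are antisymmetric in the rows and in the columns and vanish on equal indices,
  so no order of the indices has to be assumed, before or after applying \<sigma>.\<close>

lemma row_perm_bvar: "row_perm \<sigma> (bvar i j p q) = bvar (\<sigma> i) (\<sigma> j) p q"
proof -
  have diag: "bvar x x p q = 0" "bvar i j x x = 0" for x i j p q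
    by (simp_all add: bvar_def skew_def)
  have skew_eq: "skew f x y = f x y" if "\<And>x y. f y x = - f x y" "\<And>x. f x x = 0"
    for f :: "nat \<Rightarrow> nat \<Rightarrow> 'b::ab_group_add" and x y
    using that by (metis linorder_neqE_nat minus_minus skew_def)
  have subst_skew: "subst g (skew f x y) = skew (\<lambda>x y. subst g (f x y)) x y"
    for g :: "'x \<Rightarrow> ('y, 'a) mpoly" and f x y
    by (simp add: skew_def subst_uminus)
  have cols: "skew (bvar i j) p q = bvar i j p q" for i j p q
    by (rule skew_eq) (rule bvar_swap_cols, rule diag)
  have "skew (\<lambda>i j. bvar (\<sigma> i) (\<sigma> j) p q) i j = bvar (\<sigma> i) (\<sigma> j) p q"
    by (rule skew_eq) (rule bvar_swap_rows, rule diag)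
  then show ?thesis
    by (simp add: row_perm_def row_subst_def bvar_def[of i j] subst_skew subst_Var cols)
qed

lemma row_perm_hom:
  "row_perm \<sigma> (p + q) = row_perm \<sigma> p + row_perm \<sigma> q"
  "row_perm \<sigma> (p - q) = row_perm \<sigma> p - row_perm \<sigma> q"
  "row_perm \<sigma> (- p) = - row_perm \<sigma> p"
  "row_perm \<sigma> (p * q) = row_perm \<sigma> p * row_perm \<sigma> q"
  "row_perm \<sigma> (sum g F) = (\<Sum>x\<in>F. row_perm \<sigma> (g x))"
  "row_perm \<sigma> (Const a) = Const a"
  "row_perm \<sigma> 0 = 0"
  unfolding row_perm_def by (rule row_subst_simps)+

lemmas row_perm_simps = row_perm_hom row_perm_bvar

lemma row_perm_row_perm: "row_perm \<sigma> (row_perm \<tau> p) = row_perm (\<sigma> \<circ> \<tau>) p"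
proof -
  have "row_perm \<sigma> (row_perm \<tau> p) = subst (\<lambda>x. row_perm \<sigma> ((\<lambda>((i, j), (p, q)).
      \<Sum>k\<in>{\<tau> i}. \<Sum>l\<in>{\<tau> j}. bvar k l p q) x)) p"
    unfolding row_perm_def row_subst_def subst_subst ..
  also have "\<dots> = row_perm (\<sigma> \<circ> \<tau>) p"
    unfolding row_perm_def[of "\<sigma> \<circ> \<tau>"] row_subst_def
    by (rule arg_cong2[where f = subst]) (auto simp: row_perm_bvar)
  finally show ?thesis .
qed

definition partners :: "nat \<Rightarrow> nat \<Rightarrow> bool" where
  "partners a b \<longleftrightarrow> {a, b} \<in> {{1, 2}, {3, 4}, {5, 6}, {7, 8}}"

abbreviation swap_rows :: "nat \<Rightarrow> nat \<Rightarrow> (minor_idx, 'k::comm_ring_1) mpoly \<Rightarrow> (minor_idx, 'k) mpoly" where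
  "swap_rows a b \<equiv> row_perm (transpose a b)"

lemma swap_rows_bvar:
  "swap_rows a b (bvar i j p q) = bvar (if i = a then b else if i = b then a else i)
     (if j = a then b else if j = b then a else j) p q"
  by (simp add: row_perm_bvar transpose_def)

lemmas swap_rows_simps = row_perm_hom swap_rows_bvar

definition words ::
    "nat \<Rightarrow> nat \<Rightarrow> nat \<Rightarrow> nat \<Rightarrow> nat \<Rightarrow> nat \<Rightarrow> nat \<Rightarrow> nat \<Rightarrow> nat \<Rightarrow> (minor_idx, 'k::field) mpoly set" where
  "words n a b c d e f g h =
     {bvar a b p q * bvar c d r s * bvar e f t u * bvar g h v w | p q r s t u v w.
        {p, q, r, s, t, u, v, w} \<subseteq> {1..n}}"

text \<open>The relations together with everything that antisymmetrization over partner rows sends to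
  relations and products of minors whose rows are partners.\<close>

definition straight :: "nat \<Rightarrow> (minor_idx, 'k::field) mpoly set" where
  "straight n = mpoly.span (decomposable 8 n \<union> words n 1 2 3 4 5 6 7 8 \<union>
     {g + swap_rows a b g | g a b. partners a b})"

lemma subspace_straight: "mpoly.subspace (straight n)"
  by (simp add: straight_def)

lemma straight_add: "g \<in> straight n \<Longrightarrow> h \<in> straight n \<Longrightarrow> g + h \<in> straight n"
  and straight_diff: "g \<in> straight n \<Longrightarrow> h \<in> straight n \<Longrightarrow> g - h \<in> straight n"
  and straight_neg: "g \<in> straight n \<Longrightarrow> - g \<in> straight n"
  using subspace_straight mpoly.subspace_add mpoly.subspace_diff mpoly.subspace_neg
  by blast+

lemma straight_neg_iff: "- g \<in> straight n \<longleftrightarrow> g \<in> straight n"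
  using straight_neg[of g n] straight_neg[of "- g" n] by auto

lemma straight_half:
  fixes g :: "(minor_idx, 'k::field_char_0) mpoly"
  assumes "g + g \<in> straight n"
  shows "g \<in> straight n"
proof -
  have "Const (1/2) * (g + g) \<in> straight n"
    using mpoly.subspace_scale[OF subspace_straight assms] .
  also have "Const (1/2) * (g + g) = Const (1/2 + 1/2) * g"
    by (simp only: Const_add distrib_left distrib_right)
  finally show ?thesis by simp
qed

lemma straight_swap: "partners a b \<Longrightarrow> g + swap_rows a b g \<in> straight n"
  unfolding straight_def by (rule mpoly.span_base) blast

text \<open>Modulo \<open>straight\<close> a partner exchange acts as -1. An element that the
  exchange also fixes equals its own negative, and 2 is invertible.\<close>

lemma straight_antisym:
  fixes g :: "(minor_idx, 'k::field_char_0) mpoly"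
  assumes "partners a b" "g - swap_rows a b g \<in> straight n"
  shows "g \<in> straight n"
  using straight_add[OF assms(2) straight_swap[OF assms(1), of g n]]
  by - (rule straight_half, simp)

lemma straight_decomposable: "g \<in> decomposable 8 n \<Longrightarrow> g \<in> straight n"
  and straight_standard: "g \<in> words n 1 2 3 4 5 6 7 8 \<Longrightarrow> g \<in> straight n"
  unfolding straight_def by (rule mpoly.span_base, blast)+

section \<open>Exchanging the ends of paths of two and three edges\<close>

definition graded :: "nat \<Rightarrow> nat \<Rightarrow> (minor_idx, 'k::field) mpoly set" where
  "graded n d = S2 8 n \<inter> homogeneous d"

lemma graded_add: "g \<in> graded n d \<Longrightarrow> h \<in> graded n d \<Longrightarrow> g + h \<in> graded n d"
  and graded_diff: "g \<in> graded n d \<Longrightarrow> h \<in> graded n d \<Longrightarrow> g - h \<in> graded n d"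
  and graded_mult: "g \<in> graded n d \<Longrightarrow> h \<in> graded n e \<Longrightarrow> g * h \<in> graded n (d + e)"
  using S2_add[of g 8 n "- h"] homogeneous_add[of g d "- h"]
  by (simp_all add: graded_def S2_add S2_mult homogeneous_add homogeneous_mult S2_uminus
      homogeneous_uminus)

lemma graded_mult2: "g \<in> graded n 1 \<Longrightarrow> h \<in> graded n 1 \<Longrightarrow> g * h \<in> graded n 2"
  and graded_mult3: "g \<in> graded n 2 \<Longrightarrow> h \<in> graded n 1 \<Longrightarrow> g * h \<in> graded n 3"
  using graded_mult[of g n 1 h 1] graded_mult[of g n 2 h 1] by (simp_all add: numeral_eq_Suc)

lemma graded_bvar: "{i, j} \<subseteq> {1..8} \<Longrightarrow> {p, q} \<subseteq> {1..n} \<Longrightarrow> bvar i j p q \<in> graded n 1"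
  using bvar_homogeneous[of i j p q] bvar_S2[of i 8 j p n q] by (auto simp: graded_def)

lemmas graded_intros = graded_add graded_diff graded_mult2 graded_mult3 graded_bvar

lemma straight_rel3:
  assumes "g \<in> graded n 3" "minor_map g = 0" "h \<in> graded n 1"
  shows "g * h \<in> straight n"
  using decomposable_mult[of h 8 n g] assms
  by (auto simp: graded_def mult.commute intro: straight_decomposable)

lemma straight_rel2:
  assumes "g \<in> graded n 2" "minor_map g = 0" "h \<in> graded n 1" "h' \<in> graded n 1"
  shows "g * (h * h') \<in> straight n"
  using straight_rel3[of "g * h" n h'] assms
  by (simp add: graded_mult3 minor_map_simps mult.assoc)

lemma partners_rows: "partners a b \<Longrightarrow> a \<in> {1..8} \<and> b \<in> {1..8} \<and> a \<noteq> b"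
  by (auto simp: partners_def doubleton_eq_iff)

text \<open>The word is a path from \<open>x\<close> to \<open>y\<close> through the pair
  \<open>b\<close>, \<open>b'\<close>. Antisymmetrizing a monomial in rows \<open>x\<close>,
  \<open>b\<close>, \<open>b'\<close>, \<open>y\<close> under both exchanges turns it into a minor
  in rows \<open>x\<close>, \<open>y\<close> times a minor in rows \<open>b\<close>,
  \<open>b'\<close>; these products are covered by \<open>base\<close>. The factors
  \<open>h\<close>, \<open>h'\<close> are fixed by the exchange of \<open>b\<close> and
  \<open>b'\<close>, so they do not disturb the antisymmetrization.\<close>

lemma path2:
  fixes h h' :: "(minor_idx, 'k::field_char_0) mpoly"
  assumes b: "partners b b'" and rows: "{x, y} \<subseteq> {1..8} - {b, b'}"
    and cols: "{p, q, r, s} \<subseteq> {1..n}"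
    and h: "h \<in> graded n 1" "h' \<in> graded n 1"
    and inv: "swap_rows b b' h = h" "swap_rows b b' h' = h'"
    and base: "\<And>i j k l. {i, j, k, l} \<subseteq> {1..n} \<Longrightarrow> bvar x y i j * bvar b b' k l * (h * h') \<in> straight n"
  shows "bvar x b p q * bvar b' y r s * (h * h') - bvar y b p q * bvar b' x r s * (h * h')
    \<in> straight n"
    (is "?g \<in> _")
proof (rule straight_antisym[OF b])
  have bb: "{b, b'} \<subseteq> {1..8}" using partners_rows[OF b] by auto
  \<comment> \<open>The last four terms belong to the four monomials of the first product: the
    columns of \<open>x\<close> and \<open>y\<close> go to the minor in rows \<open>x\<close>,
    \<open>y\<close>, those of \<open>b\<close> and \<open>b'\<close> to the other one.\<close>
  define R :: "(minor_idx, 'k) mpoly" where "R =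
    bvar x b p q * bvar b' y r s - bvar y b p q * bvar b' x r s
     - (bvar x b' p q * bvar b y r s - bvar y b' p q * bvar b x r s)
    - (bvar x y p s * bvar b b' q r - bvar x y p r * bvar b b' q s
      - bvar x y q s * bvar b b' p r + bvar x y q r * bvar b b' p s)"
  have "R \<in> graded n 2"
    unfolding R_def using bb rows cols by (intro graded_intros) auto
  moreover have "minor_map R = 0"
    by (simp add: R_def minor_map_simps minor_map_bvar algebra_simps)
  ultimately have "R * (h * h') \<in> straight n"
    using straight_rel2 h by blast
  moreover have "bvar x y p s * bvar b b' q r * (h * h') - bvar x y p r * bvar b b' q s * (h * h')
      - bvar x y q s * bvar b b' p r * (h * h') + bvar x y q r * bvar b b' p s * (h * h') \<in> straight n"
    using cols by (intro straight_add straight_diff base) auto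
  moreover have "?g - swap_rows b b' ?g = R * (h * h') +
      (bvar x y p s * bvar b b' q r * (h * h') - bvar x y p r * bvar b b' q s * (h * h')
      - bvar x y q s * bvar b b' p r * (h * h') + bvar x y q r * bvar b b' p s * (h * h'))"
    using rows partners_rows[OF b] by (simp add: R_def swap_rows_simps inv algebra_simps)
  ultimately show "?g - swap_rows b b' ?g \<in> straight n"
    by (simp only: straight_add)
qed

text \<open>The cubic analogue of \<open>path2\<close>, with two inner pairs. The difference of the
  two words is antisymmetrized in both pairs, so the conclusion applies
  \<open>straight_antisym\<close> once for each pair.\<close>

lemma path3:
  fixes h :: "(minor_idx, 'k::field_char_0) mpoly"
  assumes b: "partners b b'" and c: "partners c c'"
    and rows: "{x, y} \<subseteq> {1..8} - {b, b', c, c'}" "{b, b'} \<inter> {c, c'} = {}"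
    and cols: "{p, q, r, s, t, u} \<subseteq> {1..n}"
    and h: "h \<in> graded n 1"
    and inv: "swap_rows b b' h = h" "swap_rows c c' h = h"
    and base: "\<And>i j k l v w. {i, j, k, l, v, w} \<subseteq> {1..n} \<Longrightarrow>
      bvar x y i j * bvar b b' k l * bvar c c' v w * h \<in> straight n"
  shows "bvar x b p q * bvar b' c r s * bvar c' y t u * h
    - bvar y b p q * bvar b' c r s * bvar c' x t u * h \<in> straight n"
    (is "?g \<in> _")
proof -
  have bb: "{b, b', c, c'} \<subseteq> {1..8}" using partners_rows[OF b] partners_rows[OF c] by auto
  have ne: "b \<noteq> c" "b \<noteq> c'" "b' \<noteq> c" "b' \<noteq> c'" using rows(2) by auto
  define P :: "nat \<Rightarrow> nat \<Rightarrow> (minor_idx, 'k) mpoly" where "P x y =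
    bvar x b p q * bvar b' c r s * bvar c' y t u - bvar x b' p q * bvar b c r s * bvar c' y t u
    - (bvar x b p q * bvar b' c' r s * bvar c y t u - bvar x b' p q * bvar b c' r s * bvar c y t u)"
    for x y
  define T :: "nat \<Rightarrow> nat \<Rightarrow> nat \<Rightarrow> nat \<Rightarrow> nat \<Rightarrow> nat \<Rightarrow> (minor_idx, 'k) mpoly" where
    "T i j k l v w = bvar x y i j * bvar b b' k l * bvar c c' v w" for i j k l v w
  \<comment> \<open>One term for each of the eight monomials of the product of three minors; the
    signs are those of the column exchanges \<open>p\<close>/\<open>q\<close>,
    \<open>r\<close>/\<open>s\<close> and \<open>t\<close>/\<open>u\<close>.\<close>
  define L where "L = T p u q r s t - T q u p r s t - T p u q s r t + T q u p s r t
    - T p t q r s u + T q t p r s u + T p t q s r u - T q t p s r u"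
  have "P x y - P y x - L \<in> graded n 3"
    unfolding P_def L_def T_def using bb rows cols by (intro graded_intros) auto
  moreover have "minor_map (P x y - P y x - L) = 0"
    by (simp add: P_def L_def T_def minor_map_simps minor_map_bvar algebra_simps)
  ultimately have "(P x y - P y x - L) * h \<in> straight n"
    using straight_rel3 h by blast
  moreover have "T p u q r s t * h - T q u p r s t * h - T p u q s r t * h + T q u p s r t * h
    - T p t q r s u * h + T q t p r s u * h + T p t q s r u * h - T q t p s r u * h \<in> straight n"
    using cols unfolding T_def by (intro straight_add straight_diff base) auto
  then have "L * h \<in> straight n"
    by (simp add: L_def algebra_simps)
  ultimately have "(P x y - P y x - L) * h + L * h \<in> straight n"
    by (rule straight_add)
  also have "(P x y - P y x - L) * h + L * h =
      (?g - swap_rows b b' ?g) - swap_rows c c' (?g - swap_rows b b' ?g)"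
    using rows(1) partners_rows[OF b] partners_rows[OF c] unfolding P_def
    by (simp add: ne ne[symmetric] swap_rows_simps inv algebra_simps)
  finally show ?thesis
    by - (rule straight_antisym[OF b], rule straight_antisym[OF c])
qed

section \<open>Graphs of partner rows\<close>

lemma wordsI:
  "{p, q, r, s, t, u, v, w} \<subseteq> {1..n} \<Longrightarrow>
    bvar a b p q * bvar c d r s * bvar e f t u * bvar g h v w \<in> words n a b c d e f g h"
  unfolding words_def by blast

lemma wordsE:
  assumes "x \<in> words n a b c d e f g h"
  obtains p q r s t u v w where "{p, q, r, s, t, u, v, w} \<subseteq> {1..n}"
    "x = bvar a b p q * bvar c d r s * bvar e f t u * bvar g h v w"
  using assms unfolding words_def by blast

lemma words_swap12: "words n c d a b e f g h \<subseteq> words n a b c d e f g h"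
proof
  fix x assume "x \<in> words n c d a b e f g h"
  then obtain p q r s t u v w where *: "{p, q, r, s, t, u, v, w} \<subseteq> {1..n}"
    "x = bvar c d p q * bvar a b r s * bvar e f t u * bvar g h v w" by (rule wordsE)
  show "x \<in> words n a b c d e f g h"
    using wordsI[of r s p q t u v w n a b c d e f g h] * by (auto simp: ac_simps)
qed

lemma words_swap23: "words n a b e f c d g h \<subseteq> words n a b c d e f g h"
proof
  fix x assume "x \<in> words n a b e f c d g h"
  then obtain p q r s t u v w where *: "{p, q, r, s, t, u, v, w} \<subseteq> {1..n}"
    "x = bvar a b p q * bvar e f r s * bvar c d t u * bvar g h v w" by (rule wordsE)
  show "x \<in> words n a b c d e f g h"
    using wordsI[of p q t u r s v w n a b c d e f g h] * by (auto simp: ac_simps)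
qed

lemma words_swap34: "words n a b c d g h e f \<subseteq> words n a b c d e f g h"
proof
  fix x assume "x \<in> words n a b c d g h e f"
  then obtain p q r s t u v w where *: "{p, q, r, s, t, u, v, w} \<subseteq> {1..n}"
    "x = bvar a b p q * bvar c d r s * bvar g h t u * bvar e f v w" by (rule wordsE)
  show "x \<in> words n a b c d e f g h"
    using wordsI[of p q r s v w t u n a b c d e f g h] * by (auto simp: ac_simps)
qed

text \<open>The relations redistribute columns among the minors, so the claim is made for all
  columns at once and only the graph remains. The argument of type \<open>itself\<close> fixes the
  field, which the numerical arguments do not determine.\<close>

definition straight_rows ::
    "'k::field itself \<Rightarrow> nat \<Rightarrow> nat \<Rightarrow> nat \<Rightarrow> nat \<Rightarrow> nat \<Rightarrow> nat \<Rightarrow> nat \<Rightarrow> nat \<Rightarrow> nat \<Rightarrow> bool" where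
  "straight_rows k n a b c d e f g h \<longleftrightarrow>
     words n a b c d e f g h \<subseteq> (straight n :: (minor_idx, 'k) mpoly set)"

lemma straight_rowsD:
  "straight_rows TYPE('k::field) n a b c d e f g h \<Longrightarrow> {p, q, r, s, t, u, v, w} \<subseteq> {1..n} \<Longrightarrow>
   (bvar a b p q * bvar c d r s * bvar e f t u * bvar g h v w :: (minor_idx, 'k) mpoly) \<in> straight n"
  unfolding straight_rows_def by (rule subsetD[OF _ wordsI])

lemma straight_rowsI:
  "(\<And>p q r s t u v w. {p, q, r, s, t, u, v, w} \<subseteq> {1..n} \<Longrightarrow>
     (bvar a b p q * bvar c d r s * bvar e f t u * bvar g h v w :: (minor_idx, 'k) mpoly) \<in> straight n)
   \<Longrightarrow> straight_rows TYPE('k::field) n a b c d e f g h"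
  unfolding straight_rows_def by (rule subsetI, erule wordsE) simp

lemma swap12: "straight_rows k n a b c d e f g h \<Longrightarrow> straight_rows k n c d a b e f g h"
  and swap23: "straight_rows k n a b c d e f g h \<Longrightarrow> straight_rows k n a b e f c d g h"
  and swap34: "straight_rows k n a b c d e f g h \<Longrightarrow> straight_rows k n a b c d g h e f"
  unfolding straight_rows_def
  using words_swap12[of n c d a b] words_swap23[of n a b e f] words_swap34[of n a b c d g h]
  by (meson subset_trans)+

lemma flip1:
  fixes k :: "'k::field itself"
  assumes "straight_rows k n a b c d e f g h" shows "straight_rows k n b a c d e f g h"
proof -
  have "straight_rows TYPE('k) n b a c d e f g h"
  proof (rule straight_rowsI)
    fix p q r s t u v w assume "{p, q, r, s, t, u, v, w} \<subseteq> {1..n}"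
    then have "(bvar a b p q * bvar c d r s * bvar e f t u * bvar g h v w :: (minor_idx, 'k) mpoly)
      \<in> straight n"
      using assms unfolding straight_rows_def by (blast intro: wordsI)
    then show "(bvar b a p q * bvar c d r s * bvar e f t u * bvar g h v w :: (minor_idx, 'k) mpoly)
      \<in> straight n"
      by (simp add: bvar_swap_rows[of b a] straight_neg_iff)
  qed
  then show ?thesis by (simp add: straight_rows_def)
qed

lemma flip2: "straight_rows k n a b c d e f g h \<Longrightarrow> straight_rows k n a b d c e f g h"
  by (rule swap12, rule flip1, rule swap12)

lemma flip3: "straight_rows k n a b c d e f g h \<Longrightarrow> straight_rows k n a b c d f e g h"
  by (rule swap23, rule flip2, rule swap23)

lemma flip4: "straight_rows k n a b c d e f g h \<Longrightarrow> straight_rows k n a b c d e f h g"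
  by (rule swap34, rule flip3, rule swap34)

section \<open>Loops and cycles of length at most 4\<close>

lemma partners_sym: "partners a b \<longleftrightarrow> partners b a"
  by (simp add: partners_def insert_commute)

lemma partners_unique: "partners a b \<Longrightarrow> partners a c \<Longrightarrow> b = c"
  by (auto simp: partners_def doubleton_eq_iff)

lemma partners_ex: "a \<in> {1..8} \<Longrightarrow> \<exists>b. partners a b"
proof -
  have "{1..8} = {1, 2, 3, 4, 5, 6, 7, 8::nat}" by auto
  moreover assume "a \<in> {1..8}"
  ultimately have "a \<in> {1, 2, 3, 4, 5, 6, 7, 8}" by simp
  then show ?thesis
    by (auto simp: partners_def doubleton_eq_iff)
qed

lemma four_loops:
  assumes "partners a b" "partners c d" "partners e f" "partners g h" "distinct [a, c, e, g, b, d, f, h]"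
  shows "straight_rows k n a b c d e f g h"
proof -
  have ex: "\<exists>i\<in>{1,3,5,7}. x = i \<and> y = i + 1 \<or> x = i + 1 \<and> y = i" if "partners x y" for x y :: nat
    using that by (auto simp: partners_def doubleton_eq_iff)
  obtain i where i: "i \<in> {1,3,5,7}" "a = i \<and> b = i + 1 \<or> a = i + 1 \<and> b = i" using ex[OF assms(1)] by blast
  obtain j where j: "j \<in> {1,3,5,7}" "c = j \<and> d = j + 1 \<or> c = j + 1 \<and> d = j" using ex[OF assms(2)] by blast
  obtain l where l: "l \<in> {1,3,5,7}" "e = l \<and> f = l + 1 \<or> e = l + 1 \<and> f = l" using ex[OF assms(3)] by blast
  obtain z where z: "z \<in> {1,3,5,7}" "g = z \<and> h = z + 1 \<or> g = z + 1 \<and> h = z" using ex[OF assms(4)] by blast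
  define P where "P i j l z \<longleftrightarrow> straight_rows k n i (i + 1) j (j + 1) l (l + 1) z (z + 1)" for i j l z
  have sym: "P j i l z = P i j l z" "P i l j z = P i j l z" "P i j z l = P i j l z" for i j l z
    unfolding P_def by (auto intro: swap12 swap23 swap34)
  have "straight_rows k n 1 2 3 4 5 6 7 8"
    unfolding straight_rows_def by (rule subsetI, rule straight_standard)
  then have "P 1 3 5 7"
    by (simp add: P_def numeral_2_eq_2)
  moreover have "i \<noteq> j" "i \<noteq> l" "i \<noteq> z" "j \<noteq> l" "j \<noteq> z" "l \<noteq> z"
    using i(2) j(2) l(2) z(2) assms(5) by (elim disjE; simp)+
  \<comment> \<open>The equations \<open>sym\<close> act as permutative rewrite rules that sort the
    arguments of \<open>P\<close>; cases with a repeated index contradict the inequalities.\<close>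
  ultimately have "P i j l z"
    using i(1) j(1) l(1) z(1)
    by (elim insertE emptyE) (simp_all add: sym)
  then have "straight_rows k n a b j (j + 1) l (l + 1) z (z + 1)"
    unfolding P_def using i(2) flip1 by blast
  then have "straight_rows k n a b c d l (l + 1) z (z + 1)"
    using j(2) flip2 by blast
  then have "straight_rows k n a b c d e f z (z + 1)"
    using l(2) flip3 by blast
  then show ?thesis
    using z(2) flip4 by blast
qed

text \<open>For ends that are partners, \<open>path2\<close> says that their exchange fixes the word
  modulo \<open>straight\<close>, while as a partner exchange it also negates it.
  \<open>three_cycle\<close> argues in the same way from \<open>path3\<close>.\<close>

lemma two_cycle:
  fixes k :: "'k::field_char_0 itself"
  assumes a: "partners a a'" and b: "partners b b'"
    and rows: "distinct [a, a', b, b', e, f, g, h]" "{e, f, g, h} \<subseteq> {1..8}"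
    and base: "straight_rows k n a a' b b' e f g h"
  shows "straight_rows k n a b b' a' e f g h"
proof -
  have base: "straight_rows TYPE('k) n a a' b b' e f g h" using base by (simp add: straight_rows_def)
  have "straight_rows TYPE('k) n a b b' a' e f g h"
  proof (rule straight_rowsI)
    fix p q r s t u v w assume cols: "{p, q, r, s, t, u, v, w} \<subseteq> {1..n}"
    let ?h = "bvar e f t u :: (minor_idx, 'k) mpoly" and ?h' = "bvar g h v w :: (minor_idx, 'k) mpoly"
    let ?g = "bvar a b p q * bvar b' a' r s * (?h * ?h')"
    have "?g - bvar a' b p q * bvar b' a r s * (?h * ?h') \<in> straight n"
    proof (rule path2[OF b])
      fix i j k l assume "{i, j, k, l} \<subseteq> {1..n}"
      then show "bvar a a' i j * bvar b b' k l * (?h * ?h') \<in> straight n"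
        using straight_rowsD[OF base, of i j k l t u v w] cols by (simp add: mult.assoc)
    qed (use rows cols partners_rows[OF a] in \<open>auto simp: swap_rows_bvar intro!: graded_bvar[simplified]\<close>)
    also have "bvar a' b p q * bvar b' a r s * (?h * ?h') = swap_rows a a' ?g"
      using rows by (auto simp: swap_rows_simps)
    finally have "?g \<in> straight n" by (rule straight_antisym[OF a])
    then show "bvar a b p q * bvar b' a' r s * ?h * ?h' \<in> straight n"
      by (simp add: mult.assoc)
  qed
  then show ?thesis by (simp add: straight_rows_def)
qed

lemma three_cycle:
  fixes k :: "'k::field_char_0 itself"
  assumes a: "partners a a'" and b: "partners b b'" and c: "partners c c'"
    and rows: "distinct [a, a', b, b', c, c', e, f]" "{e, f} \<subseteq> {1..8}"
    and base: "straight_rows k n a a' b b' c c' e f"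
  shows "straight_rows k n a b b' c c' a' e f"
proof -
  have base: "straight_rows TYPE('k) n a a' b b' c c' e f" using base by (simp add: straight_rows_def)
  have "straight_rows TYPE('k) n a b b' c c' a' e f"
  proof (rule straight_rowsI)
    fix p q r s t u v w assume cols: "{p, q, r, s, t, u, v, w} \<subseteq> {1..n}"
    let ?h = "bvar e f v w :: (minor_idx, 'k) mpoly"
    let ?g = "bvar a b p q * bvar b' c r s * bvar c' a' t u * ?h"
    have "?g - bvar a' b p q * bvar b' c r s * bvar c' a t u * ?h \<in> straight n"
    proof (rule path3[OF b c])
      fix i j k l x y assume "{i, j, k, l, x, y} \<subseteq> {1..n}"
      then show "bvar a a' i j * bvar b b' k l * bvar c c' x y * ?h \<in> straight n"
        using straight_rowsD[OF base, of i j k l x y v w] cols by simp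
    qed (use rows cols partners_rows[OF a] in \<open>auto simp: swap_rows_bvar intro!: graded_bvar[simplified]\<close>)
    also have "bvar a' b p q * bvar b' c r s * bvar c' a t u * ?h = swap_rows a a' ?g"
      using rows by (auto simp: swap_rows_simps)
    finally show "?g \<in> straight n" by (rule straight_antisym[OF a])
  qed
  then show ?thesis by (simp add: straight_rows_def)
qed

lemma four_cycle:
  fixes k :: "'k::field_char_0 itself"
  assumes a: "partners a a'" and b: "partners b b'" and c: "partners c c'" and d: "partners d d'"
    and rows: "distinct [a, a', b, b', c, c', d, d']"
  shows "straight_rows k n a b b' c c' d d' a'"
proof -
  have in8: "{a, a', b, b', c, c', d, d'} \<subseteq> {1..8}"
    using partners_rows[OF a] partners_rows[OF b] partners_rows[OF c] partners_rows[OF d] by auto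
  have b': "partners b' b" and c': "partners c' c" and d': "partners d' d" and a': "partners a' a"
    using a b c d partners_sym by blast+
  define W :: "nat \<Rightarrow> nat \<Rightarrow> nat \<Rightarrow> nat \<Rightarrow> nat \<Rightarrow> nat \<Rightarrow> nat \<Rightarrow> nat \<Rightarrow> (minor_idx, 'k) mpoly" where
    "W p q r s t u v w = bvar a b p q * bvar b' c r s * bvar c' d t u * bvar d' a' v w"
    for p q r s t u v w
  \<comment> \<open>Exchanging the other ends of two edges at a vertex amounts to exchanging their columns.\<close>
  have swap_ab: "W p q r s t u v w + W r s p q t u v w \<in> straight n"
    if cols: "{p, q, r, s, t, u, v, w} \<subseteq> {1..n}" for p q r s t u v w
  proof -
    \<comment> \<open>The base case for \<open>path2\<close> at the pair \<open>b\<close>,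
      \<open>b'\<close>: once the loop there is split off, the other three pairs form a
      triangle.\<close>
    have "straight_rows TYPE('k) n a a' c c' d d' b b'"
      by (rule four_loops) (use assms in auto)
    then have "straight_rows TYPE('k) n a c c' d d' a' b b'"
      by (rule three_cycle[OF a c d, rotated 2]) (use rows in8 in auto)
    then have base: "straight_rows TYPE('k) n a c b b' c' d d' a'"
      by (rule swap23[OF swap34])
    let ?h = "bvar c' d t u :: (minor_idx, 'k) mpoly" and ?h' = "bvar d' a' v w :: (minor_idx, 'k) mpoly"
    let ?g = "bvar c b p q * bvar b' a r s * (?h * ?h')"
    have "bvar a b p q * bvar b' c r s * (?h * ?h') - ?g \<in> straight n"
    proof (rule path2[OF b])
      fix i j k l assume "{i, j, k, l} \<subseteq> {1..n}"
      then show "bvar a c i j * bvar b b' k l * (?h * ?h') \<in> straight n"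
        using straight_rowsD[OF base, of i j k l t u v w] cols by (simp add: mult.assoc)
    qed (use rows cols in8 in \<open>auto simp: swap_rows_bvar intro!: graded_bvar[simplified]\<close>)
    then have "bvar a b p q * bvar b' c r s * (?h * ?h') - ?g + (?g + swap_rows b b' ?g) \<in> straight n"
      by (intro straight_add straight_swap b)
    \<comment> \<open>Two minors have their rows reversed, and the two signs cancel; the sign in
      \<open>swap_ab\<close> is that of the partner exchange alone.\<close>
    moreover have "swap_rows b b' ?g = W r s p q t u v w"
      using rows by (auto simp: W_def swap_rows_simps bvar_swap_rows[of c b'] bvar_swap_rows[of b a])
    ultimately show ?thesis
      by (simp add: W_def mult.assoc)
  qed
  have swap_bc: "W p q r s t u v w + W p q t u r s v w \<in> straight n"
    if cols: "{p, q, r, s, t, u, v, w} \<subseteq> {1..n}" for p q r s t u v w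
  proof -
    have "straight_rows TYPE('k) n b' b d d' a' a c c'"
      by (rule four_loops) (use assms b' a' in auto)
    then have "straight_rows TYPE('k) n b' d d' a' a b c c'"
      by (rule three_cycle[OF b' d a', rotated 2]) (use rows in8 in auto)
    then have base: "straight_rows TYPE('k) n b' d c c' a b d' a'"
      by (rule swap34[OF swap23[OF swap34]])
    let ?h = "bvar a b p q :: (minor_idx, 'k) mpoly" and ?h' = "bvar d' a' v w :: (minor_idx, 'k) mpoly"
    let ?g = "bvar d c r s * bvar c' b' t u * (?h * ?h')"
    have "bvar b' c r s * bvar c' d t u * (?h * ?h') - ?g \<in> straight n"
    proof (rule path2[OF c])
      fix i j k l assume "{i, j, k, l} \<subseteq> {1..n}"
      then show "bvar b' d i j * bvar c c' k l * (?h * ?h') \<in> straight n"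
        using straight_rowsD[OF base, of i j k l p q v w] cols by (simp add: mult.assoc)
    qed (use rows cols in8 in \<open>auto simp: swap_rows_bvar intro!: graded_bvar[simplified]\<close>)
    then have "bvar b' c r s * bvar c' d t u * (?h * ?h') - ?g + (?g + swap_rows c c' ?g) \<in> straight n"
      by (intro straight_add straight_swap c)
    moreover have "swap_rows c c' ?g = W p q t u r s v w"
      using rows by (auto simp: W_def swap_rows_simps bvar_swap_rows[of d c'] bvar_swap_rows[of c b'] ac_simps)
    ultimately show ?thesis
      by (simp add: W_def ac_simps)
  qed
  \<comment> \<open>Exchanging the ends of the path complementary to one edge, and then of the path complementary
    to the opposite edge, restores the cycle with opposite edges exchanged.\<close>
  have swap_ac: "W p q r s t u v w - W t u r s p q v w \<in> straight n"
    if cols: "{p, q, r, s, t, u, v, w} \<subseteq> {1..n}" for p q r s t u v w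
  proof -
    \<comment> \<open>Each of the two applications of \<open>path3\<close> has as its base case two
      loops and a 2-cycle, on the pairs of \<open>a\<close>, \<open>d\<close> and of
      \<open>b\<close>, \<open>c\<close> respectively.\<close>
    have "straight_rows TYPE('k) n a a' d d' b b' c c'"
      by (rule four_loops) (use assms in auto)
    then have "straight_rows TYPE('k) n a d d' a' b b' c c'"
      by (rule two_cycle[OF a d, rotated 2]) (use rows in8 in auto)
    then have base1: "straight_rows TYPE('k) n a d b b' c c' d' a'"
      by (rule swap34[OF swap23])
    have "straight_rows TYPE('k) n b b' c' c d d' a' a"
      by (rule four_loops) (use assms a' c' in auto)
    then have "straight_rows TYPE('k) n b c' c b' d d' a' a"
      by (rule two_cycle[OF b c', rotated 2]) (use rows in8 in auto)
    then have base2: "straight_rows TYPE('k) n b c' d d' a' a b' c"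
      by (rule swap34[OF swap23[OF flip2]])
    let ?g = "bvar d b p q * bvar b' c r s * bvar c' a t u * bvar d' a' v w :: (minor_idx, 'k) mpoly"
    have "W p q r s t u v w - ?g \<in> straight n"
      unfolding W_def
    proof (rule path3[OF b c])
      fix i j k l x y assume "{i, j, k, l, x, y} \<subseteq> {1..n}"
      then show "bvar a d i j * bvar b b' k l * bvar c c' x y * bvar d' a' v w \<in> (straight n :: (minor_idx, 'k) mpoly set)"
        using straight_rowsD[OF base1, of i j k l x y v w] cols by simp
    qed (use rows cols in8 in \<open>auto simp: swap_rows_bvar intro!: graded_bvar[simplified]\<close>)
    moreover have "bvar b d p q * bvar d' a' v w * bvar a c' t u * bvar b' c r s
        - bvar c' d p q * bvar d' a' v w * bvar a b t u * bvar b' c r s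
        \<in> (straight n :: (minor_idx, 'k) mpoly set)"
    proof (rule path3[OF d a'])
      fix i j k l x y assume "{i, j, k, l, x, y} \<subseteq> {1..n}"
      then show "bvar b c' i j * bvar d d' k l * bvar a' a x y * bvar b' c r s \<in> (straight n :: (minor_idx, 'k) mpoly set)"
        using straight_rowsD[OF base2, of i j k l x y r s] cols by simp
    qed (use rows cols in8 in \<open>auto simp: swap_rows_bvar intro!: graded_bvar[simplified]\<close>)
    moreover have "bvar b d p q * bvar d' a' v w * bvar a c' t u * bvar b' c r s = ?g"
      by (simp add: bvar_swap_rows[of b d] bvar_swap_rows[of a c'] ac_simps)
    moreover have "bvar c' d p q * bvar d' a' v w * bvar a b t u * bvar b' c r s = W t u r s p q v w"
      by (simp add: W_def ac_simps)
    ultimately show ?thesis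
      using straight_add[of "W p q r s t u v w - ?g" n "?g - W t u r s p q v w"] by simp
  qed
  have "straight_rows TYPE('k) n a b b' c c' d d' a'"
  proof (rule straight_rowsI)
    fix p q r s t u v w assume cols: "{p, q, r, s, t, u, v, w} \<subseteq> {1..n}"
    then have "W p q r s t u v w + W r s p q t u v w \<in> straight n"
      and "W r s p q t u v w + W r s t u p q v w \<in> straight n"
      and "W r s t u p q v w + W t u r s p q v w \<in> straight n"
      and "W p q r s t u v w - W t u r s p q v w \<in> straight n"
      by (auto intro!: swap_ab swap_bc swap_ac)
    \<comment> \<open>Combined as (1) - (2) + (3) + (4), the intermediate words cancel and twice the
      first word is left.\<close>
    note straight_add[OF straight_add[OF straight_diff[OF this(1,2)] this(3)] this(4)]
    then have "W p q r s t u v w + W p q r s t u v w \<in> straight n"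
      by (simp add: algebra_simps)
    then have "W p q r s t u v w \<in> straight n" by (rule straight_half)
    then show "bvar a b p q * bvar b' c r s * bvar c' d t u * bvar d' a' v w
        \<in> (straight n :: (minor_idx, 'k) mpoly set)"
      by (simp add: W_def)
  qed
  then show ?thesis by (simp add: straight_rows_def)
qed

section \<open>Case analysis over the 2-regular multigraphs on four vertices\<close>

definition bijective_rows :: "nat \<Rightarrow> nat \<Rightarrow> nat \<Rightarrow> nat \<Rightarrow> nat \<Rightarrow> nat \<Rightarrow> nat \<Rightarrow> nat \<Rightarrow> bool" where
  "bijective_rows a b c d e f g h \<longleftrightarrow>
     distinct [a, b, c, d, e, f, g, h] \<and> {a, b, c, d, e, f, g, h} \<subseteq> {1..8}"

text \<open>By cardinality the eight rows exhaust \<open>{1..8}\<close>, so a walk that passes from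
  an end of an edge to its partner always finds a next edge.\<close>

lemma partner_in:
  assumes "bijective_rows a b c d e f g h" "x \<in> {a, b, c, d, e, f, g, h}"
  obtains y where "partners x y" "partners y x" "y \<in> {a, b, c, d, e, f, g, h} - {x}"
proof -
  have "card {a, b, c, d, e, f, g, h} = card {1..8::nat}"
    using assms(1) by (simp add: bijective_rows_def)
  then have all: "{a, b, c, d, e, f, g, h} = {1..8}"
    using assms(1) by (intro card_subset_eq) (simp_all only: bijective_rows_def finite_atLeastAtMost)
  with assms(2) have "x \<in> {1..8}" by simp
  from partners_ex[OF this] obtain y where y: "partners x y" by blast
  from partners_rows[OF y] have "y \<in> {a, b, c, d, e, f, g, h} - {x}"
    unfolding all by simp
  with y show ?thesis
    by (intro that[of y]) (simp_all add: partners_sym[of y])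
qed

text \<open>The other two pairs carry either two more loops or a 2-cycle.\<close>

lemma two_loops:
  fixes k :: "'k::field_char_0 itself"
  assumes "partners a b" "partners c d" and bij: "bijective_rows a b c d e f g h"
  shows "straight_rows k n a b c d e f g h"
proof -
  have rows: "distinct [a, b, c, d, e, f, g, h]" "{a, b, c, d, e, f, g, h} \<subseteq> {1..8}"
    using bij by (simp_all add: bijective_rows_def)
  have sym: "partners b a" "partners d c" using assms partners_sym by blast+
  have no: "\<not> partners y x" if "x \<in> {e, f, g, h}" "y \<in> {a, b, c, d}" for x y
    using that assms(1,2) sym rows(1) partners_unique by auto
  obtain e' where e': "partners e e'" "partners e' e" "e' \<in> {a, b, c, d, e, f, g, h} - {e}"
    using partner_in[OF bij, of e] by blast
  obtain f' where f': "partners f f'" "partners f' f" "f' \<in> {a, b, c, d, e, f, g, h} - {f}"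
    using partner_in[OF bij, of f] by blast
  obtain g' where g': "partners g g'" "partners g' g" "g' \<in> {a, b, c, d, e, f, g, h} - {g}"
    using partner_in[OF bij, of g] by blast
  from e' no consider "e' = f" | "e' = g" | "e' = h" by blast
  then show ?thesis
  proof cases
    case 1
    have "g' \<noteq> e" "g' \<noteq> f"
      using 1 e' g' rows(1) partners_unique[of e f g] partners_unique[of f e g] by auto
    with no[of g] g' have "g' = h" by blast
    with 1 e' g' show ?thesis
      using rows assms by (intro four_loops) auto
  next
    case 2
    have "f' \<noteq> e" "f' \<noteq> g"
      using 2 e' f' rows(1) partners_unique[of e g f] partners_unique[of g e f] by auto
    with no[of f] f' have "f' = h" by blast
    have "straight_rows k n e g f h a b c d"
      using rows assms 2 \<open>f' = h\<close> e' f' by (intro four_loops) auto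
    then have "straight_rows k n e f h g a b c d"
      by (rule two_cycle[rotated 4]) (use rows 2 \<open>f' = h\<close> e' f' in auto)
    then show ?thesis
      by (rule swap23[OF swap34[OF swap12[OF swap23[OF flip2]]]])
  next
    case 3
    have "f' \<noteq> e" "f' \<noteq> h"
      using 3 e' f' rows(1) partners_unique[of e h f] partners_unique[of h e f] by auto
    with no[of f] f' have "f' = g" by blast
    have "straight_rows k n e h f g a b c d"
      using rows assms 3 \<open>f' = g\<close> e' f' by (intro four_loops) auto
    then have "straight_rows k n e f g h a b c d"
      by (rule two_cycle[rotated 4]) (use rows 3 \<open>f' = g\<close> e' f' in auto)
    then show ?thesis
      by (rule swap23[OF swap34[OF swap12[OF swap23]]])
  qed
qed

text \<open>The walk along \<open>c d\<close> and \<open>e f\<close> either closes up at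
  \<open>c\<close>, so that \<open>g h\<close> is a second loop, or passes through
  \<open>g h\<close> and closes up as a 3-cycle.\<close>

lemma one_loop_aux:
  fixes k :: "'k::field_char_0 itself"
  assumes "partners a b" "partners d e" and bij: "bijective_rows a b c d e f g h"
  shows "straight_rows k n a b c d e f g h"
proof -
  have rows: "distinct [a, b, c, d, e, f, g, h]" "{a, b, c, d, e, f, g, h} \<subseteq> {1..8}"
    using bij by (simp_all add: bijective_rows_def)
  have sym: "partners b a" "partners e d" using assms partners_sym by blast+
  have no: "\<not> partners y x" if "x \<in> {c, f, g, h}" "y \<in> {a, b, d, e}" for x y
    using that assms(1,2) sym rows(1) partners_unique by auto
  obtain f' where f': "partners f f'" "partners f' f" "f' \<in> {a, b, c, d, e, f, g, h} - {f}"
    using partner_in[OF bij, of f] by blast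
  obtain c' where c': "partners c c'" "partners c' c" "c' \<in> {a, b, c, d, e, f, g, h} - {c}"
    using partner_in[OF bij, of c] by blast
  obtain g' where g': "partners g g'" "partners g' g" "g' \<in> {a, b, c, d, e, f, g, h} - {g}"
    using partner_in[OF bij, of g] by blast
  from f' no consider "f' = c" | "f' = g" | "f' = h" by blast
  then show ?thesis
  proof cases
    case 1
    have "g' \<noteq> f" "g' \<noteq> c"
      using 1 f' g' rows(1) partners_unique[of f c g] partners_unique[of c f g] by auto
    with no[of g] g' have "g' = h" by blast
    have "straight_rows k n a b g h c d e f"
      using bij assms g' \<open>g' = h\<close> by (intro two_loops) (auto simp: bijective_rows_def)
    then show ?thesis by (rule swap34[OF swap23])
  next
    case 2
    have "c' \<noteq> f" "c' \<noteq> g"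
      using 2 f' c' rows(1) partners_unique[of f g c] partners_unique[of g f c] by auto
    with no[of c] c' have "c' = h" by blast
    have "straight_rows k n c h d e f g a b"
      using rows assms 2 \<open>c' = h\<close> f' c' by (intro four_loops) auto
    then have "straight_rows k n c d e f g h a b"
      by (rule three_cycle[rotated 5]) (use rows assms 2 \<open>c' = h\<close> f' c' in auto)
    then show ?thesis by (rule swap12[OF swap23[OF swap34]])
  next
    case 3
    have "c' \<noteq> f" "c' \<noteq> h"
      using 3 f' c' rows(1) partners_unique[of f h c] partners_unique[of h f c] by auto
    with no[of c] c' have "c' = g" by blast
    have "straight_rows k n c g d e f h a b"
      using rows assms 3 \<open>c' = g\<close> f' c' by (intro four_loops) auto
    then have "straight_rows k n c d e f h g a b"
      by (rule three_cycle[rotated 5]) (use rows assms 3 \<open>c' = g\<close> f' c' in auto)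
    then show ?thesis by (rule swap12[OF swap23[OF swap34[OF flip3]]])
  qed
qed

text \<open>The walk continues from \<open>d\<close>. Reordering the edges and flipping their ends
  brings the partner of \<open>d\<close> to the place of \<open>e\<close>, unless it is
  \<open>c\<close> and there is a second loop.\<close>

lemma one_loop:
  fixes k :: "'k::field_char_0 itself"
  assumes "partners a b" and bij: "bijective_rows a b c d e f g h"
  shows "straight_rows k n a b c d e f g h"
proof -
  have rows: "distinct [a, b, c, d, e, f, g, h]"
    using bij by (simp add: bijective_rows_def)
  obtain d' where d': "partners d d'" "partners d' d" "d' \<in> {a, b, c, d, e, f, g, h} - {d}"
    using partner_in[OF bij, of d] by blast
  have sym: "partners b a" using assms partners_sym by blast
  have "d' \<notin> {a, b}"
    using d' assms(1) sym rows partners_unique by auto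
  with d' consider "d' = c" | "d' = e" | "d' = f" | "d' = g" | "d' = h" by blast
  then show ?thesis
  proof cases
    case 1
    with d' assms show ?thesis by (intro two_loops) auto
  next
    case 2
    with d' assms show ?thesis by (intro one_loop_aux) auto
  next
    case 3
    with d' assms have "straight_rows k n a b c d f e g h"
      by (intro one_loop_aux) (auto simp: bijective_rows_def)
    then show ?thesis by (rule flip3)
  next
    case 4
    with d' assms have "straight_rows k n a b c d g h e f"
      by (intro one_loop_aux) (auto simp: bijective_rows_def)
    then show ?thesis by (rule swap34)
  next
    case 5
    with d' assms have "straight_rows k n a b c d h g e f"
      by (intro one_loop_aux) (auto simp: bijective_rows_def)
    then show ?thesis by (rule swap34[OF flip3])
  qed
qed

text \<open>Three edges form a path from \<open>a\<close> to \<open>f\<close>. It closes up as a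
  3-cycle, leaving the loop \<open>g h\<close>, or takes in \<open>g h\<close> and becomes a
  4-cycle.\<close>

lemma no_loop_aux2:
  fixes k :: "'k::field_char_0 itself"
  assumes "partners b c" "partners d e" and bij: "bijective_rows a b c d e f g h"
  shows "straight_rows k n a b c d e f g h"
proof -
  have rows: "distinct [a, b, c, d, e, f, g, h]" "{a, b, c, d, e, f, g, h} \<subseteq> {1..8}"
    using bij by (simp_all add: bijective_rows_def)
  have sym: "partners c b" "partners e d" using assms partners_sym by blast+
  have no: "\<not> partners y x" if "x \<in> {a, f, g, h}" "y \<in> {b, c, d, e}" for x y
    using that assms(1,2) sym rows(1) partners_unique by auto
  obtain f' where f': "partners f f'" "partners f' f" "f' \<in> {a, b, c, d, e, f, g, h} - {f}"
    using partner_in[OF bij, of f] by blast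
  obtain a' where a': "partners a a'" "partners a' a" "a' \<in> {a, b, c, d, e, f, g, h} - {a}"
    using partner_in[OF bij, of a] by blast
  obtain g' where g': "partners g g'" "partners g' g" "g' \<in> {a, b, c, d, e, f, g, h} - {g}"
    using partner_in[OF bij, of g] by blast
  from f' no consider "f' = a" | "f' = g" | "f' = h" by blast
  then show ?thesis
  proof cases
    case 1
    have "g' \<noteq> f" "g' \<noteq> a"
      using 1 f' g' rows(1) partners_unique[of f a g] partners_unique[of a f g] by auto
    with no[of g] g' have "g' = h" by blast
    have "straight_rows k n g h a b c d e f"
      using bij g' \<open>g' = h\<close> by (intro one_loop) (auto simp: bijective_rows_def)
    then show ?thesis by (rule swap34[OF swap23[OF swap12]])
  next
    case 2
    have "a' \<noteq> f" "a' \<noteq> g"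
      using 2 f' a' rows(1) partners_unique[of f g a] partners_unique[of g f a] by auto
    with no[of a] a' have "a' = h" by blast
    with 2 show ?thesis
      using rows assms f' a' by (intro four_cycle) auto
  next
    case 3
    have "a' \<noteq> f" "a' \<noteq> h"
      using 3 f' a' rows(1) partners_unique[of f h a] partners_unique[of h f a] by auto
    with no[of a] a' have "a' = g" by blast
    with 3 have "straight_rows k n a b c d e f h g"
      using rows assms f' a' by (intro four_cycle) auto
    then show ?thesis by (rule flip4)
  qed
qed

lemma no_loop_aux:
  fixes k :: "'k::field_char_0 itself"
  assumes "partners b c" and bij: "bijective_rows a b c d e f g h"
  shows "straight_rows k n a b c d e f g h"
proof -
  have rows: "distinct [a, b, c, d, e, f, g, h]" "{a, b, c, d, e, f, g, h} \<subseteq> {1..8}"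
    using bij by (simp_all add: bijective_rows_def)
  obtain d' where d': "partners d d'" "partners d' d" "d' \<in> {a, b, c, d, e, f, g, h} - {d}"
    using partner_in[OF bij, of d] by blast
  have sym: "partners c b" using assms partners_sym by blast
  have "d' \<notin> {b, c}"
    using d' assms(1) sym rows partners_unique by auto
  with d' consider "d' = a" | "d' = e" | "d' = f" | "d' = g" | "d' = h" by blast
  then show ?thesis
  proof cases
    case 1
    \<comment> \<open>The edges \<open>a b\<close> and \<open>c d\<close> form a 2-cycle. Resolving
      it produces two loops, whatever the other two edges do, so a pair of 2-cycles is covered as
      well.\<close>
    with d' assms have "straight_rows k n a d b c e f g h"
      by (intro two_loops) (auto simp: bijective_rows_def)
    then show ?thesis
      by (rule two_cycle[rotated 4]) (use rows 1 assms d' in auto)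
  next
    case 2
    with d' assms show ?thesis by (intro no_loop_aux2) auto
  next
    case 3
    with d' assms have "straight_rows k n a b c d f e g h"
      by (intro no_loop_aux2) (auto simp: bijective_rows_def)
    then show ?thesis by (rule flip3)
  next
    case 4
    with d' assms have "straight_rows k n a b c d g h e f"
      by (intro no_loop_aux2) (auto simp: bijective_rows_def)
    then show ?thesis by (rule swap34)
  next
    case 5
    with d' assms have "straight_rows k n a b c d h g e f"
      by (intro no_loop_aux2) (auto simp: bijective_rows_def)
    then show ?thesis by (rule swap34[OF flip3])
  qed
qed

lemma straight_rows_bijective:
  fixes k :: "'k::field_char_0 itself"
  assumes bij: "bijective_rows a b c d e f g h"
  shows "straight_rows k n a b c d e f g h"
proof -
  obtain b' where b': "partners b b'" "partners b' b" "b' \<in> {a, b, c, d, e, f, g, h} - {b}"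
    using partner_in[OF bij, of b] by blast
  then consider "b' = a" | "b' = c" | "b' = d" | "b' = e" | "b' = f" | "b' = g" | "b' = h" by blast
  then show ?thesis
  proof cases
    case 1
    with b' bij show ?thesis by (intro one_loop) auto
  next
    case 2
    with b' bij show ?thesis by (intro no_loop_aux) auto
  next
    case 3
    with b' bij have "straight_rows k n a b d c e f g h"
      by (intro no_loop_aux) (auto simp: bijective_rows_def)
    then show ?thesis by (rule flip2)
  next
    case 4
    with b' bij have "straight_rows k n a b e f c d g h"
      by (intro no_loop_aux) (auto simp: bijective_rows_def)
    then show ?thesis by (rule swap23)
  next
    case 5
    with b' bij have "straight_rows k n a b f e c d g h"
      by (intro no_loop_aux) (auto simp: bijective_rows_def)
    then show ?thesis by (rule swap23[OF flip2])
  next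
    case 6
    with b' bij have "straight_rows k n a b g h c d e f"
      by (intro no_loop_aux) (auto simp: bijective_rows_def)
    then show ?thesis by (rule swap34[OF swap23])
  next
    case 7
    with b' bij have "straight_rows k n a b h g c d e f"
      by (intro no_loop_aux) (auto simp: bijective_rows_def)
    then show ?thesis by (rule swap34[OF swap23[OF flip2]])
  qed
qed

section \<open>Products of minors in disjoint rows\<close>

definition linear_ext ::
    "(('x \<Rightarrow>\<^sub>0 nat) \<Rightarrow> ('y, 'k::field) mpoly) \<Rightarrow> ('x, 'k) mpoly \<Rightarrow> ('y, 'k) mpoly" where
  "linear_ext G p = (\<Sum>t\<in>Poly_Mapping.keys p. Const (Poly_Mapping.lookup p t) * G t)"

lemma linear_ext_superset:
  assumes "finite F" "Poly_Mapping.keys p \<subseteq> F"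
  shows "linear_ext G p = (\<Sum>t\<in>F. Const (Poly_Mapping.lookup p t) * G t)"
  unfolding linear_ext_def
  by (rule sum.mono_neutral_left) (use assms in \<open>auto simp: in_keys_iff\<close>)

lemma linear_ext_add: "linear_ext G (p + q) = linear_ext G p + linear_ext G q"
proof -
  let ?F = "Poly_Mapping.keys p \<union> Poly_Mapping.keys q"
  have "Poly_Mapping.keys (p + q) \<subseteq> ?F" by (rule keys_add)
  then show ?thesis
    by (simp add: linear_ext_superset[of ?F] lookup_add Const_add algebra_simps sum.distrib)
qed

lemma linear_ext_single: "linear_ext G (Poly_Mapping.single t c) = Const c * G t"
  by (simp add: linear_ext_def)

lemma linear_ext_0: "linear_ext G 0 = 0"
  by (simp add: linear_ext_def)

lemma linear_ext_uminus: "linear_ext G (- p) = - linear_ext G p"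
proof -
  have "linear_ext G p + linear_ext G (- p) = 0"
    using linear_ext_add[of G p "- p"] linear_ext_0[of G] by simp
  then show ?thesis by (rule minus_unique[symmetric])
qed

lemma linear_ext_diff: "linear_ext G (p - q) = linear_ext G p - linear_ext G q"
  using linear_ext_add[of G p "- q"] by (simp add: linear_ext_uminus)

lemma linear_ext_Const_mult: "linear_ext G (Const c * p) = Const c * linear_ext G p"
proof (induction p rule: mpoly_induct)
  case (term_add t d p)
  have "Const c * Poly_Mapping.single t d = Poly_Mapping.single t (c * d)"
    by (simp add: Const_def mult_single)
  then have "linear_ext G (Const c * (Poly_Mapping.single t d + p))
      = Const (c * d) * G t + linear_ext G (Const c * p)"
    by (simp only: distrib_left linear_ext_add linear_ext_single)
  also have "\<dots> = Const c * linear_ext G (Poly_Mapping.single t d + p)"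
    by (simp only: term_add linear_ext_add linear_ext_single Const_mult mult.assoc distrib_left)
  finally show ?case .
qed (simp add: linear_ext_0)

text \<open>Meaningful for monomials with exactly one variable in row \<open>i\<close>, such as
  those in the image of a standard word.\<close>

definition col_of :: "(nat \<times> nat \<Rightarrow>\<^sub>0 nat) \<Rightarrow> nat \<Rightarrow> nat" where
  "col_of t i = (THE p. Poly_Mapping.lookup t (i, p) \<noteq> 0)"

text \<open>Inverts \<open>minor_map\<close> on standard words up to a factor: each monomial is read
  as the diagonal term of a product of four minors in the rows \<open>1 2\<close>,
  \<open>3 4\<close>, \<open>5 6\<close>, \<open>7 8\<close>.\<close>

definition read_off :: "(nat \<times> nat, 'k::field) mpoly \<Rightarrow> (minor_idx, 'k) mpoly" where
  "read_off = linear_ext (\<lambda>t. bvar 1 2 (col_of t 1) (col_of t 2) * bvar 3 4 (col_of t 3) (col_of t 4) *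
     bvar 5 6 (col_of t 5) (col_of t 6) * bvar 7 8 (col_of t 7) (col_of t 8))"

lemma read_off_monomial:
  "read_off (xvar 1 p * xvar 2 q * xvar 3 r * xvar 4 s * xvar 5 t * xvar 6 u * xvar 7 v * xvar 8 w)
    = bvar 1 2 p q * bvar 3 4 r s * bvar 5 6 t u * bvar 7 8 v w"
proof -
  define M where "M = Poly_Mapping.single (1::nat, p) (1::nat) + Poly_Mapping.single (2, q) 1
    + Poly_Mapping.single (3, r) 1 + Poly_Mapping.single (4, s) 1 + Poly_Mapping.single (5, t) 1
    + Poly_Mapping.single (6, u) 1 + Poly_Mapping.single (7, v) 1 + Poly_Mapping.single (8, w) 1"
  have lookup: "Poly_Mapping.lookup M (1, x) = (1 when p = x)" "Poly_Mapping.lookup M (2, x) = (1 when q = x)" "Poly_Mapping.lookup M (3, x) = (1 when r = x)" "Poly_Mapping.lookup M (4, x) = (1 when s = x)" "Poly_Mapping.lookup M (5, x) = (1 when t = x)" "Poly_Mapping.lookup M (6, x) = (1 when u = x)" "Poly_Mapping.lookup M (7, x) = (1 when v = x)" "Poly_Mapping.lookup M (8, x) = (1 when w = x)" for x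
    by (simp_all add: M_def lookup_add lookup_single)
  have the_when: "(THE x. (1 when y = x) \<noteq> (0::nat)) = y" for y :: nat
    by (rule the_equality) (simp_all add: when_def split: if_splits)
  have col: "col_of M 1 = p" "col_of M 2 = q" "col_of M 3 = r" "col_of M 4 = s" "col_of M 5 = t"
    "col_of M 6 = u" "col_of M 7 = v" "col_of M 8 = w"
    by (simp_all only: col_of_def lookup the_when)
  have "xvar 1 p * xvar 2 q * xvar 3 r * xvar 4 s * xvar 5 t * xvar 6 u * xvar 7 v * xvar 8 w =
      Poly_Mapping.single M (1 :: 'a)"
    by (simp only: Var_def mult_single M_def mult_1_left)
  then show ?thesis
    by (simp only: read_off_def linear_ext_single col Const_1 mult_1_left)
qed

text \<open>The image has 2^4 = 16 signed monomials, which differ by column exchanges inside the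
  four minors. Reading one off gives the word with the same columns exchanged, whose sign cancels
  that of the monomial.\<close>

lemma read_off_minor_map:
  assumes "x \<in> words n 1 2 3 4 5 6 7 8"
  shows "read_off (minor_map x) = Const 16 * (x :: (minor_idx, 'k::field) mpoly)"
proof -
  from assms obtain p q r s t u v w where
    x: "x = bvar 1 2 p q * bvar 3 4 r s * bvar 5 6 t u * bvar 7 8 v w"
    by (rule wordsE)
  define X :: "nat \<Rightarrow> nat \<Rightarrow> nat \<Rightarrow> nat \<Rightarrow> nat \<Rightarrow> nat \<Rightarrow> nat \<Rightarrow> nat \<Rightarrow> (nat \<times> nat, 'k) mpoly" where
    "X p q r s t u v w = xvar 1 p * xvar 2 q * xvar 3 r * xvar 4 s * xvar 5 t * xvar 6 u * xvar 7 v * xvar 8 w"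
    for p q r s t u v w
  have R: "read_off (X p q r s t u v w) = bvar 1 2 p q * bvar 3 4 r s * bvar 5 6 t u * bvar 7 8 v w"
    for p q r s t u v w
    unfolding X_def by (rule read_off_monomial)
  have "minor_map x =
    ((X p q r s t u v w - X p q r s t u w v) - (X p q r s u t v w - X p q r s u t w v)
    - ((X p q s r t u v w - X p q s r t u w v) - (X p q s r u t v w - X p q s r u t w v)))
    - ((X q p r s t u v w - X q p r s t u w v) - (X q p r s u t v w - X q p r s u t w v)
    - ((X q p s r t u v w - X q p s r t u w v) - (X q p s r u t v w - X q p s r u t w v)))"
    by (simp add: x minor_map_simps minor_map_bvar X_def algebra_simps)
  moreover have "Const 16 * y = y + y + y + y + y + y + y + y + y + y + y + y + y + y + y + y"
    for y :: "(minor_idx, 'k) mpoly"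
  proof -
    have "Const 16 = (1+1+1+1+1+1+1+1+1+1+1+1+1+1+1+1 :: (minor_idx, 'k) mpoly)"
      unfolding Const_1[symmetric] Const_add[symmetric] by simp
    then show ?thesis by (simp only: distrib_right mult_1_left)
  qed
  ultimately show ?thesis
    by (simp only: linear_ext_diff R[unfolded read_off_def] read_off_def x bvar_swap_cols[of _ _ q p]
      bvar_swap_cols[of _ _ s r] bvar_swap_cols[of _ _ u t] bvar_swap_cols[of _ _ w v]) simp
qed

lemma minor_map_inj_standard:
  assumes "x \<in> mpoly.span (words n 1 2 3 4 5 6 7 8)" "minor_map x = 0"
  shows "x = (0 :: (minor_idx, 'k::field_char_0) mpoly)"
proof -
  have "read_off (minor_map x) = Const 16 * x"
    using assms(1)
  proof (induction rule: mpoly.span_induct)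
    case base
    show ?case
      unfolding mpoly.subspace_def read_off_def
      by (simp add: linear_ext_add linear_ext_Const_mult linear_ext_0 minor_map_simps distrib_left
          mult.left_commute)
  qed (rule read_off_minor_map)
  then have "Const 16 * x = 0"
    using assms(2) by (simp add: read_off_def linear_ext_0)
  then have "Const (1/16) * (Const 16 * x) = 0" by simp
  then show ?thesis by (simp flip: mult.assoc Const_mult)
qed

section \<open>Antisymmetrization over partner rows\<close>

lemma row_perm_decomposable:
  assumes "\<sigma> permutes {1..8}" "p \<in> decomposable 8 n"
  shows "row_perm \<sigma> p \<in> decomposable 8 n"
  unfolding row_perm_def using assms(2)
  by (rule row_subst_decomposable[rotated]) (use permutes_in_image[OF assms(1)] in auto)

lemma partners_permutes: "partners a b \<Longrightarrow> transpose a b permutes {1..8}"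
  using partners_rows[of a b] by (auto intro!: permutes_swap_id)

text \<open>
  \<open>row_perm id\<close> is not the identity: it also normalizes variables with unsorted indices, which are
  junk. Hence it replaces \<open>p\<close> below.
\<close>

definition antisymm :: "nat \<Rightarrow> nat \<Rightarrow> (minor_idx, 'k::field) mpoly \<Rightarrow> (minor_idx, 'k) mpoly" where
  "antisymm a b p = row_perm id p - swap_rows a b p"

definition antisymm4 :: "(minor_idx, 'k::field) mpoly \<Rightarrow> (minor_idx, 'k) mpoly" where
  "antisymm4 p = antisymm 1 2 (antisymm 3 4 (antisymm 5 6 (antisymm 7 8 p)))"

lemma antisymm_linear:
  "antisymm a b (p + q) = antisymm a b p + antisymm a b q"
  "antisymm a b (Const c * p) = Const c * antisymm a b p"
  "antisymm a b 0 = 0"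
  by (simp_all only: antisymm_def row_perm_hom) (simp_all add: algebra_simps)

lemma antisymm4_linear:
  "antisymm4 (p + q) = antisymm4 p + antisymm4 q"
  "antisymm4 (Const c * p) = Const c * antisymm4 p"
  "antisymm4 0 = 0"
  by (simp_all only: antisymm4_def antisymm_linear)

text \<open>Lets any of the four antisymmetrizations be applied innermost, where it annihilates
  \<open>p + swap_rows a b p\<close> for its own pair.\<close>

lemma antisymm_commute:
  assumes "{a, b} \<inter> {c, d} = {}"
  shows "antisymm a b (antisymm c d p) = antisymm c d (antisymm a b p)"
proof -
  have "transpose a b \<circ> transpose c d = transpose c d \<circ> transpose a b"
    using assms by (auto simp: fun_eq_iff transpose_def)
  then show ?thesis
    by (simp only: antisymm_def row_perm_hom row_perm_row_perm comp_id id_comp) (simp add: algebra_simps)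
qed

lemma antisymm_commutes:
  "antisymm 1 2 (antisymm 3 4 p) = antisymm 3 4 (antisymm 1 2 p)"
  "antisymm 1 2 (antisymm 5 6 p) = antisymm 5 6 (antisymm 1 2 p)"
  "antisymm 1 2 (antisymm 7 8 p) = antisymm 7 8 (antisymm 1 2 p)"
  "antisymm 3 4 (antisymm 5 6 p) = antisymm 5 6 (antisymm 3 4 p)"
  "antisymm 3 4 (antisymm 7 8 p) = antisymm 7 8 (antisymm 3 4 p)"
  "antisymm 5 6 (antisymm 7 8 p) = antisymm 7 8 (antisymm 5 6 p)"
  by (rule antisymm_commute, simp)+

lemma antisymm_swap: "antisymm a b (p + swap_rows a b p) = 0"
  by (simp only: antisymm_def row_perm_hom row_perm_row_perm comp_id id_comp transpose_comp_involutory) simp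

lemma antisymm4_swap:
  assumes "partners a b"
  shows "antisymm4 (p + swap_rows a b p) = 0"
proof -
  have *: "antisymm4 (p + swap_rows a b p) = 0" if "(a, b) \<in> {(1, 2), (3, 4), (5, 6), (7, 8)}" for a b
  proof -
    from that consider "a = 1 \<and> b = 2" | "a = 3 \<and> b = 4" | "a = 5 \<and> b = 6" | "a = 7 \<and> b = 8"
      by auto
    then show ?thesis
    proof cases
      case 1
      have "antisymm4 q = antisymm 3 4 (antisymm 5 6 (antisymm 7 8 (antisymm 1 2 q)))" for q :: "(minor_idx, 'a) mpoly"
        by (simp only: antisymm4_def antisymm_commutes)
      with 1 show ?thesis by (simp only: antisymm_swap antisymm_linear(3))
    next
      case 2
      have "antisymm4 q = antisymm 1 2 (antisymm 5 6 (antisymm 7 8 (antisymm 3 4 q)))" for q :: "(minor_idx, 'a) mpoly"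
        by (simp only: antisymm4_def antisymm_commutes)
      with 2 show ?thesis by (simp only: antisymm_swap antisymm_linear(3))
    next
      case 3
      have "antisymm4 q = antisymm 1 2 (antisymm 3 4 (antisymm 7 8 (antisymm 5 6 q)))" for q :: "(minor_idx, 'a) mpoly"
        by (simp only: antisymm4_def antisymm_commutes)
      with 3 show ?thesis by (simp only: antisymm_swap antisymm_linear(3))
    next
      case 4
      then show ?thesis by (simp only: antisymm4_def antisymm_swap antisymm_linear(3))
    qed
  qed
  from assms have "(a, b) \<in> {(1, 2), (3, 4), (5, 6), (7, 8)} \<or> (b, a) \<in> {(1, 2), (3, 4), (5, 6), (7, 8)}"
    by (auto simp: partners_def doubleton_eq_iff)
  then show ?thesis
    using *[of a b] *[of b a] by (auto simp only: transpose_commute[of b a])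
qed

lemma antisymm_eq_double:
  "row_perm id p = p \<Longrightarrow> swap_rows a b p = - p \<Longrightarrow> antisymm a b p = p + p"
  by (simp add: antisymm_def)

lemma antisymm4_eq:
  fixes p :: "(minor_idx, 'k::field) mpoly"
  assumes id: "row_perm id p = p"
    and swap: "swap_rows 1 2 p = - p" "swap_rows 3 4 p = - p" "swap_rows 5 6 p = - p" "swap_rows 7 8 p = - p"
  shows "antisymm4 p = Const 16 * p"
proof -
  have id2: "row_perm id (q + q) = q + q" if "row_perm id q = q" for q :: "(minor_idx, 'k) mpoly"
    by (simp only: that row_perm_hom)
  have sw2: "swap_rows a b (q + q) = - (q + q)" if "swap_rows a b q = - q" for q :: "(minor_idx, 'k) mpoly" and a b
    by (simp only: that row_perm_hom minus_add_distrib)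
  have "antisymm4 p = p + p + (p + p) + (p + p + (p + p)) + (p + p + (p + p) + (p + p + (p + p)))"
    unfolding antisymm4_def
    by (simp only: antisymm_eq_double id swap id2 sw2)
  moreover have "Const 16 = (1 + 1 + (1 + 1) + (1 + 1 + (1 + 1)) + (1 + 1 + (1 + 1) + (1 + 1 + (1 + 1))) :: (minor_idx, 'k) mpoly)"
    unfolding Const_1[symmetric] Const_add[symmetric] by simp
  ultimately show ?thesis by (simp only: distrib_right mult_1_left)
qed

lemma antisymm_decomposable:
  "partners a b \<Longrightarrow> p \<in> decomposable 8 n \<Longrightarrow> antisymm a b p \<in> decomposable 8 n"
  unfolding antisymm_def
  by (intro mpoly.subspace_diff[OF subspace_decomposable] row_perm_decomposable permutes_id partners_permutes)

lemma antisymm4_decomposable: "p \<in> decomposable 8 n \<Longrightarrow> antisymm4 p \<in> decomposable 8 n"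
  unfolding antisymm4_def by (intro antisymm_decomposable) (simp_all add: partners_def)

lemma antisymm4_words:
  assumes "p \<in> words n 1 2 3 4 5 6 7 8"
  shows "antisymm4 p = Const 16 * p"
proof -
  from assms obtain q r s t u v w x where
    p: "p = bvar 1 2 x q * bvar 3 4 r s * bvar 5 6 t u * bvar 7 8 v w"
    by (rule wordsE)
  show ?thesis
    by (rule antisymm4_eq)
      (simp_all add: p row_perm_hom row_perm_bvar[of id] swap_rows_bvar bvar_swap_rows[of 2 "Suc 0"]
        bvar_swap_rows[of 4 3] bvar_swap_rows[of 6 5] bvar_swap_rows[of 8 7])
qed

lemma antisymm4_straight:
  assumes "p \<in> straight n"
  shows "antisymm4 p \<in> mpoly.span (decomposable 8 n \<union> words n 1 2 3 4 5 6 7 8)"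
  using assms unfolding straight_def
proof (induction rule: mpoly.span_induct)
  case base
  show ?case
    by (auto simp: mpoly.subspace_def antisymm4_linear mpoly.span_zero mpoly.span_add mpoly.span_scale)
next
  case (step x)
  then consider "x \<in> decomposable 8 n" | "x \<in> words n 1 2 3 4 5 6 7 8" |
    g a b where "x = g + swap_rows a b g" "partners a b" by blast
  then show ?case
  proof cases
    case 1
    then show ?thesis by (intro mpoly.span_base UnI1 antisymm4_decomposable)
  next
    case 2
    then show ?thesis
      by (simp only: antisymm4_words) (intro mpoly.span_scale mpoly.span_base UnI2)
  next
    case 3
    then show ?thesis by (simp add: antisymm4_swap mpoly.span_zero)
  qed
qed

lemma Const_mult_cancel:
  assumes "mpoly.subspace V" "Const c * p \<in> V" "c \<noteq> 0"
  shows "p \<in> V"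
proof -
  have "Const (1 / c) * (Const c * p) \<in> V"
    by (rule mpoly.subspace_scale[OF assms(1,2)])
  also have "Const (1 / c) * (Const c * p) = p"
    using assms(3) by (simp flip: mult.assoc Const_mult)
  finally show ?thesis .
qed

text \<open>Antisymmetrizing multiplies \<open>p\<close> by 16 and annihilates the generators
  \<open>g + swap_rows a b g\<close> of \<open>straight\<close>. What remains is a decomposable
  element plus a combination of standard words; the latter is again a relation, hence zero by linear
  independence of the images.\<close>

lemma decomposable_antisymmetric:
  fixes p :: "(minor_idx, 'k::field_char_0) mpoly"
  assumes p: "p \<in> straight n" "p \<in> J2 8 n" and id: "row_perm id p = p"
    and swap: "swap_rows 1 2 p = - p" "swap_rows 3 4 p = - p" "swap_rows 5 6 p = - p" "swap_rows 7 8 p = - p"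
  shows "p \<in> decomposable 8 n"
proof -
  have "Const 16 * p \<in> mpoly.span (decomposable 8 n \<union> words n 1 2 3 4 5 6 7 8)"
    using antisymm4_straight[OF p(1)] antisymm4_eq[OF id swap] by simp
  then obtain d w where dw: "Const 16 * p = d + w" "d \<in> decomposable 8 n"
    "w \<in> mpoly.span (words n 1 2 3 4 5 6 7 8)"
    unfolding mpoly.span_Un mpoly.span_eq_iff[THEN iffD2, OF subspace_decomposable] by auto
  have "d \<in> J2 8 n" using dw(2) decomposable_subset by blast
  then have "minor_map w = 0"
    using p(2) arg_cong[OF dw(1), of minor_map] by (simp add: J2_def minor_map_simps)
  with dw(3) have "w = 0" by (intro minor_map_inj_standard)
  with dw have "Const 16 * p \<in> decomposable 8 n" by simp
  then show ?thesis
    by (rule Const_mult_cancel[OF subspace_decomposable]) simp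
qed

section \<open>Equivariant projection onto the relations\<close>

definition multilinear :: "nat \<Rightarrow> (minor_idx, 'k::field) mpoly set" where
  "multilinear n = {x. \<exists>a b c d e f g h. bijective_rows a b c d e f g h \<and> x \<in> words n a b c d e f g h}"

lemma multilinear_straight:
  "mpoly.span (multilinear n) \<subseteq> (straight n :: (minor_idx, 'k::field_char_0) mpoly set)"
  by (rule mpoly.span_minimal[OF _ subspace_straight])
    (auto simp: multilinear_def dest!: straight_rows_bijective[where k = "TYPE('k)"] simp: straight_rows_def)

lemma row_perm_words:
  "x \<in> words n a b c d e f g h \<Longrightarrow>
    row_perm \<sigma> x \<in> words n (\<sigma> a) (\<sigma> b) (\<sigma> c) (\<sigma> d) (\<sigma> e) (\<sigma> f) (\<sigma> g) (\<sigma> h)"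
  by (erule wordsE) (simp only: row_perm_simps wordsI)

lemma bijective_rows_permutes:
  assumes "\<sigma> permutes {1..8}" "bijective_rows a b c d e f g h"
  shows "bijective_rows (\<sigma> a) (\<sigma> b) (\<sigma> c) (\<sigma> d) (\<sigma> e) (\<sigma> f) (\<sigma> g) (\<sigma> h)"
  using assms(2) permutes_in_image[OF assms(1)]
  by (simp add: bijective_rows_def inj_eq[OF permutes_inj[OF assms(1)]])

lemma row_perm_span_multilinear:
  assumes "\<sigma> permutes {1..8}" "x \<in> mpoly.span (multilinear n)"
  shows "row_perm \<sigma> x \<in> mpoly.span (multilinear n)"
  using assms(2)
proof (induction rule: mpoly.span_induct)
  case base
  show ?case
    by (auto simp: mpoly.subspace_def row_perm_hom mpoly.span_zero mpoly.span_add mpoly.span_scale)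
next
  case (step x)
  then obtain a b c d e f g h where "bijective_rows a b c d e f g h" "x \<in> words n a b c d e f g h"
    unfolding multilinear_def by blast
  from bijective_rows_permutes[OF assms(1) this(1)] row_perm_words[OF this(2), of \<sigma>]
  show ?case
    unfolding multilinear_def by (intro mpoly.span_base) blast
qed

lemma row_perm_id_multilinear:
  assumes "x \<in> mpoly.span (multilinear n)"
  shows "row_perm id x = x"
  using assms
proof (induction rule: mpoly.span_induct)
  case base
  show ?case by (auto simp: mpoly.subspace_def row_perm_hom)
next
  case (step x)
  then obtain a b c d e f g h where "x \<in> words n a b c d e f g h"
    unfolding multilinear_def by blast
  then show ?case
    by (rule wordsE) (simp add: row_perm_simps)
qed

lemma of_nat_Const: "of_nat k = Const (of_nat k)"
  by (induction k) (simp_all add: Const_add)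

text \<open>Every arrangement of the eight rows is a permutation of the standard one, so the
  standard words generate all multilinear words under row permutations.\<close>

lemma bijective_rows_ex_permutes:
  assumes "bijective_rows a b c d e f g h"
  obtains \<tau> where "\<tau> permutes {1..8}" "\<tau> 1 = a" "\<tau> 2 = b" "\<tau> 3 = c" "\<tau> 4 = d"
    "\<tau> 5 = e" "\<tau> 6 = f" "\<tau> 7 = g" "\<tau> 8 = h"
proof -
  define \<tau> where "\<tau> i = (if i \<in> {1..8} then [a, b, c, d, e, f, g, h] ! (i - 1) else i)" for i
  have inj: "inj_on \<tau> {1..8}"
  proof (rule inj_onI)
    fix i j assume "i \<in> {1..8::nat}" "j \<in> {1..8::nat}" "\<tau> i = \<tau> j"
    then have "[a, b, c, d, e, f, g, h] ! (i - 1) = [a, b, c, d, e, f, g, h] ! (j - 1)"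
      by (simp add: \<tau>_def)
    moreover have "i - 1 < length [a, b, c, d, e, f, g, h]" "j - 1 < length [a, b, c, d, e, f, g, h]"
      using \<open>i \<in> {1..8}\<close> \<open>j \<in> {1..8}\<close> by auto
    ultimately have "i - 1 = j - 1"
      using assms nth_eq_iff_index_eq unfolding bijective_rows_def by blast
    then show "i = j" using \<open>i \<in> {1..8}\<close> \<open>j \<in> {1..8}\<close> by auto
  qed
  have "\<tau> i \<in> {1..8}" if i: "i \<in> {1..8}" for i
  proof -
    have "i - 1 < length [a, b, c, d, e, f, g, h]" using i by auto
    then have "\<tau> i \<in> set [a, b, c, d, e, f, g, h]"
      using i nth_mem by (simp only: \<tau>_def if_True)
    then show ?thesis using assms by (auto simp: bijective_rows_def)
  qed
  then have "\<tau> ` {1..8} \<subseteq> {1..8}" by blast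
  then have "\<tau> ` {1..8} = {1..8}" using inj by (intro endo_inj_surj) auto
  then have "\<tau> permutes {1..8}"
    using inj by (intro bij_imp_permutes) (auto simp: bij_betw_def \<tau>_def)
  moreover have "\<tau> 1 = a" "\<tau> 2 = b" "\<tau> 3 = c" "\<tau> 4 = d" "\<tau> 5 = e" "\<tau> 6 = f" "\<tau> 7 = g" "\<tau> 8 = h"
    by (simp_all add: \<tau>_def)
  ultimately show ?thesis by (rule that)
qed

text \<open>The relations \<open>V\<close> are stable under row permutations inside
  \<open>U\<close>, which the standard words generate. An equivariant map from \<open>U\<close> to
  \<open>V\<close> that is a nonzero scalar on \<open>V\<close> therefore makes the images of
  standard words generate \<open>V\<close>, and these inherit the antisymmetry of standard
  words.\<close>

lemma multilinear_decomposable: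
  assumes "f \<in> mpoly.span (multilinear n)" "f \<in> J2 8 n"
  shows "f \<in> (decomposable 8 n :: (minor_idx, 'k::field_char_0) mpoly set)"
proof -
  define U where "U = mpoly.span (multilinear n :: (minor_idx, 'k) mpoly set)"
  define V where "V = U \<inter> J2 8 n"
  define P where "P = {\<sigma>. \<sigma> permutes {1..8::nat}}"
  have subU: "mpoly.subspace U" by (simp add: U_def)
  have subV: "mpoly.subspace V"
    unfolding V_def by (intro mpoly.subspace_inter subU subspace_J2)
  have finP: "finite P" and P_ne: "card P \<noteq> 0"
    by (simp_all add: P_def finite_permutations card_permutations)
  have PV: "row_perm \<sigma> v \<in> V" if "\<sigma> \<in> P" "v \<in> V" for \<sigma> v
  proof -
    have \<sigma>: "\<sigma> permutes {1..8}" using that by (simp add: P_def)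
    have "row_perm \<sigma> v \<in> J2 8 n"
      unfolding row_perm_def
      by (rule row_subst_J2) (use that permutes_in_image[OF \<sigma>] in \<open>auto simp: V_def\<close>)
    then show ?thesis
      using that row_perm_span_multilinear[OF \<sigma>, of v n] by (simp add: V_def U_def)
  qed
  let ?scale = "\<lambda>(c :: 'k) (p :: (minor_idx, 'k) mpoly). Const c * p"
  have "vector_space_pair ?scale ?scale"
    by (simp add: vector_space_pair_def mpoly.vector_space_axioms)
  moreover have "Vector_Spaces.linear ?scale ?scale id"
    by (simp add: Vector_Spaces.linear_iff mpoly.vector_space_axioms)
  \<comment> \<open>A left inverse of the inclusion of \<open>V\<close>, that is, a linear
    projection onto \<open>V\<close> that need not be equivariant.\<close>
  ultimately obtain p0 where p0: "range p0 \<subseteq> V" "Vector_Spaces.linear ?scale ?scale p0"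
    "\<And>v. v \<in> V \<Longrightarrow> p0 v = v"
    using vector_space_pair.linear_exists_left_inverse_on[of ?scale ?scale id V] subV by auto
  have lin: "p0 (x + y) = p0 x + p0 y" "p0 (Const c * x) = Const c * p0 x" for x y c
    using p0(2) by (simp_all add: Vector_Spaces.linear_iff)
  \<comment> \<open>The average from Maschke's theorem, left unnormalized: on \<open>V\<close> it is
    multiplication by \<open>card P\<close>.\<close>
  define p where "p x = (\<Sum>\<sigma>\<in>P. row_perm (inv \<sigma>) (p0 (row_perm \<sigma> x)))" for x
  have p_add: "p (x + y) = p x + p y" for x y
    by (simp add: p_def row_perm_hom lin sum.distrib)
  have p_scale: "p (Const c * x) = Const c * p x" for c x
    by (simp add: p_def row_perm_hom lin sum_distrib_left)
  have p_0: "p 0 = 0" using p_scale[of 0 0] by simp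
  have p_neg: "p (- x) = - p x" for x
    using p_add[of x "- x"] by (simp add: p_0 add_eq_0_iff)
  have p_V: "p x \<in> V" for x
    unfolding p_def using p0(1)
    by (intro mpoly.subspace_sum[OF subV] PV) (auto simp: P_def permutes_inv)
  have p_equivariant: "row_perm \<tau> (p x) = p (row_perm \<tau> x)" if \<tau>: "\<tau> \<in> P" for \<tau> x
  proof -
    have \<tau>': "\<tau> permutes {1..8}" using \<tau> by (simp add: P_def)
    have "row_perm \<tau> (p x) = (\<Sum>\<sigma>\<in>P. row_perm (\<tau> \<circ> inv \<sigma>) (p0 (row_perm \<sigma> x)))"
      by (simp only: p_def row_perm_hom row_perm_row_perm)
    also have "\<dots> = (\<Sum>\<rho>\<in>P. row_perm (inv \<rho>) (p0 (row_perm (\<rho> \<circ> \<tau>) x)))"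
    proof (rule sum.reindex_bij_witness[of _ "\<lambda>\<rho>. \<rho> \<circ> \<tau>" "\<lambda>\<sigma>. \<sigma> \<circ> inv \<tau>"])
      fix \<sigma> assume \<sigma>: "\<sigma> \<in> P"
      then have \<sigma>': "\<sigma> permutes {1..8}" by (simp add: P_def)
      show "\<sigma> \<circ> inv \<tau> \<circ> \<tau> = \<sigma>"
        by (simp add: comp_assoc permutes_inv_o[OF \<tau>'])
      show "\<sigma> \<circ> \<tau> \<circ> inv \<tau> = \<sigma>"
        by (simp add: comp_assoc permutes_inv_o[OF \<tau>'])
      show "\<sigma> \<circ> inv \<tau> \<in> P" "\<sigma> \<circ> \<tau> \<in> P"
        using \<sigma>' \<tau>' by (simp_all add: P_def permutes_compose permutes_inv)
      have "inv (\<sigma> \<circ> inv \<tau>) = \<tau> \<circ> inv \<sigma>"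
        using permutes_bij[OF \<sigma>'] permutes_bij[OF permutes_inv[OF \<tau>']] permutes_bij[OF \<tau>']
        by (simp add: o_inv_distrib inv_inv_eq)
      then show "row_perm (inv (\<sigma> \<circ> inv \<tau>)) (p0 (row_perm (\<sigma> \<circ> inv \<tau> \<circ> \<tau>) x)) =
          row_perm (\<tau> \<circ> inv \<sigma>) (p0 (row_perm \<sigma> x))"
        by (simp add: comp_assoc permutes_inv_o[OF \<tau>'])
    qed
    also have "\<dots> = p (row_perm \<tau> x)"
      by (simp only: p_def row_perm_row_perm)
    finally show ?thesis .
  qed
  have p_id: "p v = Const (of_nat (card P)) * v" if v: "v \<in> V" for v
  proof -
    have "row_perm (inv \<sigma>) (p0 (row_perm \<sigma> v)) = v" if "\<sigma> \<in> P" for \<sigma>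
    proof -
      have "\<sigma> permutes {1..8}" using that by (simp add: P_def)
      then have "row_perm (inv \<sigma>) (row_perm \<sigma> v) = row_perm id v"
        by (simp add: row_perm_row_perm permutes_inv_o)
      moreover have "p0 (row_perm \<sigma> v) = row_perm \<sigma> v"
        by (rule p0(3)[OF PV[OF that v]])
      ultimately show ?thesis
        using v row_perm_id_multilinear[of v n] by (simp add: V_def U_def)
    qed
    then show ?thesis by (simp add: p_def flip: of_nat_Const)
  qed
  have std: "p x \<in> decomposable 8 n" if x: "x \<in> words n 1 2 3 4 5 6 7 8" for x
  proof (rule decomposable_antisymmetric)
    have V: "p x \<in> V" by (rule p_V)
    show "p x \<in> straight n" "p x \<in> J2 8 n"
      using V multilinear_straight[of n] by (auto simp: V_def U_def)
    show "row_perm id (p x) = p x"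
      using V row_perm_id_multilinear by (auto simp: V_def U_def)
    have sw: "swap_rows a b (p x) = - p x" if "swap_rows a b x = - x" "partners a b" for a b
      using p_equivariant[of "transpose a b" x] partners_permutes[OF that(2)]
      by (simp add: that(1) p_neg P_def)
    from x obtain q r s t u v w y where
      x: "x = bvar 1 2 y q * bvar 3 4 r s * bvar 5 6 t u * bvar 7 8 v w"
      by (rule wordsE)
    have "swap_rows 1 2 x = - x" "swap_rows 3 4 x = - x" "swap_rows 5 6 x = - x" "swap_rows 7 8 x = - x"
      by (simp_all add: x row_perm_hom swap_rows_bvar bvar_swap_rows[of 2 "Suc 0"]
        bvar_swap_rows[of 4 3] bvar_swap_rows[of 6 5] bvar_swap_rows[of 8 7])
    then show "swap_rows 1 2 (p x) = - p x" "swap_rows 3 4 (p x) = - p x"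
      "swap_rows 5 6 (p x) = - p x" "swap_rows 7 8 (p x) = - p x"
      by (auto intro!: sw simp: partners_def)
  qed
  have "p x \<in> decomposable 8 n" if "x \<in> U" for x
    using that unfolding U_def
  proof (induction rule: mpoly.span_induct)
    case base
    show ?case
      using subspace_decomposable[of 8 n] by (auto simp: mpoly.subspace_def p_0 p_add p_scale)
  next
    case (step x)
    then obtain a b c d e f g h where bij: "bijective_rows a b c d e f g h"
      and "x \<in> words n a b c d e f g h" by (auto simp: multilinear_def)
    then obtain q r s t u v w y where cols: "{y, q, r, s, t, u, v, w} \<subseteq> {1..n}"
      and x: "x = bvar a b y q * bvar c d r s * bvar e f t u * bvar g h v w"
      by (auto elim!: wordsE)
    obtain \<tau> where \<tau>: "\<tau> permutes {1..8}" "\<tau> 1 = a" "\<tau> 2 = b" "\<tau> 3 = c" "\<tau> 4 = d"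
      "\<tau> 5 = e" "\<tau> 6 = f" "\<tau> 7 = g" "\<tau> 8 = h"
      using bijective_rows_ex_permutes[OF bij] .
    let ?x = "bvar 1 2 y q * bvar 3 4 r s * bvar 5 6 t u * bvar 7 8 v w :: (minor_idx, 'k) mpoly"
    have "row_perm \<tau> (p ?x) \<in> decomposable 8 n"
      using cols by (intro row_perm_decomposable \<tau>(1) std wordsI)
    moreover have "row_perm \<tau> ?x = x"
      by (simp only: x row_perm_simps \<tau>)
    ultimately show ?case
      using p_equivariant[of \<tau> ?x] \<tau>(1) by (simp add: P_def)
  qed
  from this[of f] have "Const (of_nat (card P)) * f \<in> decomposable 8 n"
    using assms p_id[of f] by (simp add: U_def V_def)
  then show ?thesis
    by (rule Const_mult_cancel[OF subspace_decomposable]) (simp add: P_ne)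
qed

section \<open>Polarization\<close>

lemma sum_PiE_insert:
  assumes "x \<notin> S"
  shows "(\<Sum>\<kappa>\<in>Pi\<^sub>E (insert x S) A. g \<kappa>) = (\<Sum>y\<in>A x. \<Sum>\<kappa>\<in>Pi\<^sub>E S A. g (\<kappa>(x := y)))"
  unfolding PiE_insert_eq sum.reindex[OF inj_combinator[OF assms]]
  by (simp add: sum.cartesian_product case_prod_unfold)

section \<open>Quartic monomials as assignments of rows and columns\<close>

definition word :: "(nat \<Rightarrow> nat) \<Rightarrow> (nat \<Rightarrow> nat) \<Rightarrow> (minor_idx, 'k::comm_ring_1) mpoly" where
  "word \<kappa> \<rho> = bvar (\<kappa> 1) (\<kappa> 2) (\<rho> 1) (\<rho> 2) * bvar (\<kappa> 3) (\<kappa> 4) (\<rho> 3) (\<rho> 4) *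
     bvar (\<kappa> 5) (\<kappa> 6) (\<rho> 5) (\<rho> 6) * bvar (\<kappa> 7) (\<kappa> 8) (\<rho> 7) (\<rho> 8)"

lemma atLeastAtMost_8: "{1..8} = {1, 2, 3, 4, 5, 6, 7, 8::nat}"
  by auto

lemma sum_word_PiE:
  "(\<Sum>\<kappa>\<in>Pi\<^sub>E {1..8} A. word \<kappa> \<rho>) =
    (\<Sum>k\<in>A 1. \<Sum>l\<in>A 2. bvar k l (\<rho> 1) (\<rho> 2)) * (\<Sum>k\<in>A 3. \<Sum>l\<in>A 4. bvar k l (\<rho> 3) (\<rho> 4)) *
    (\<Sum>k\<in>A 5. \<Sum>l\<in>A 6. bvar k l (\<rho> 5) (\<rho> 6)) * (\<Sum>k\<in>A 7. \<Sum>l\<in>A 8. bvar k l (\<rho> 7) (\<rho> 8))"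
proof -
  have "(\<Sum>\<kappa>\<in>Pi\<^sub>E {1..8} A. word \<kappa> \<rho>) =
    (\<Sum>a\<in>A 1. \<Sum>b\<in>A 2. \<Sum>c\<in>A 3. \<Sum>d\<in>A 4. \<Sum>e\<in>A 5. \<Sum>f\<in>A 6. \<Sum>g\<in>A 7. \<Sum>h\<in>A 8.
      bvar a b (\<rho> 1) (\<rho> 2) * bvar c d (\<rho> 3) (\<rho> 4) * bvar e f (\<rho> 5) (\<rho> 6) * bvar g h (\<rho> 7) (\<rho> 8))"
    unfolding atLeastAtMost_8 by (simp add: sum_PiE_insert word_def)
  also have "\<dots> = (\<Sum>k\<in>A 1. \<Sum>l\<in>A 2. bvar k l (\<rho> 1) (\<rho> 2)) * (\<Sum>k\<in>A 3. \<Sum>l\<in>A 4. bvar k l (\<rho> 3) (\<rho> 4)) *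
    (\<Sum>k\<in>A 5. \<Sum>l\<in>A 6. bvar k l (\<rho> 5) (\<rho> 6)) * (\<Sum>k\<in>A 7. \<Sum>l\<in>A 8. bvar k l (\<rho> 7) (\<rho> 8))"
    by (simp only: sum_distrib_left[symmetric] sum_distrib_right[symmetric])
  finally show ?thesis .
qed

text \<open>The slots 1 to 8 are the places of the rows and columns in four minors. The strict order
  within each minor makes every factor of \<open>word\<close> a genuine variable, on which
  \<open>row_subst\<close> acts by its defining formula.\<close>

definition sorted_words :: "nat \<Rightarrow> nat \<Rightarrow> ((nat \<Rightarrow> nat) \<times> (nat \<Rightarrow> nat)) set" where
  "sorted_words m n = {(i, \<rho>). i ` {1..8} \<subseteq> {1..m} \<and> \<rho> ` {1..8} \<subseteq> {1..n} \<and>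
     (\<forall>(a, b)\<in>{(1, 2), (3, 4), (5, 6), (7, 8)}. i a < i b \<and> \<rho> a < \<rho> b)}"

lemma row_subst_word:
  assumes "(i, \<rho>) \<in> sorted_words m n"
  shows "row_subst c (word i \<rho> :: (minor_idx, 'k::comm_ring_1) mpoly)
    = (\<Sum>\<kappa>\<in>Pi\<^sub>E {1..8} (\<lambda>s. c (i s)). word \<kappa> \<rho>)"
proof -
  have "row_subst c (bvar i j p q :: (minor_idx, 'k) mpoly) = (\<Sum>k\<in>c i. \<Sum>l\<in>c j. bvar k l p q)"
    if "i < j" "p < q" for i j p q
    using that by (simp add: bvar_def[of i j] skew_def[of _ i j] skew_def[of _ p q] row_subst_def subst_Var)
  then show ?thesis
    using assms unfolding sum_word_PiE by (simp add: word_def row_subst_simps sorted_words_def)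
qed

lemma mon_degree_Suc:
  assumes "mon_degree t = Suc d"
  obtains y s where "t = Poly_Mapping.single y 1 + s" "mon_degree s = d"
    "y \<in> Poly_Mapping.keys t" "Poly_Mapping.keys s \<subseteq> Poly_Mapping.keys t"
proof -
  have "Poly_Mapping.keys t \<noteq> {}"
    using assms by (auto simp: mon_degree_def)
  then obtain y where y: "y \<in> Poly_Mapping.keys t" by blast
  define s where "s = t - Poly_Mapping.single y 1"
  have t: "t = Poly_Mapping.single y 1 + s"
    using y by (intro poly_mapping_eqI)
      (auto simp: s_def lookup_add lookup_minus lookup_single when_def in_keys_iff)
  have "Suc (mon_degree s) = Suc d"
    using assms unfolding t mon_degree_add by (simp add: mon_degree_def)
  moreover have "Poly_Mapping.keys s \<subseteq> Poly_Mapping.keys t"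
    by (auto simp: s_def in_keys_iff lookup_minus)
  ultimately show ?thesis using t y by (intro that) auto
qed

lemma homogeneous_4_span:
  assumes "f \<in> S2 m n" "f \<in> homogeneous 4"
  shows "f \<in> mpoly.span {word i \<rho> | i \<rho>. (i, \<rho>) \<in> sorted_words m n}"
proof -
  have "Poly_Mapping.single t (1::'a) \<in> {word i \<rho> | i \<rho>. (i, \<rho>) \<in> sorted_words m n}"
    if t: "t \<in> Poly_Mapping.keys f" for t
  proof -
    have "mon_degree t = Suc (Suc (Suc (Suc 0)))" and keys: "Poly_Mapping.keys t \<subseteq> minor_indices m n"
      using t assms by (auto simp: homogeneous_def S2_def poly_ring_def)
    then obtain y1 t1 where 1: "t = Poly_Mapping.single y1 1 + t1" "mon_degree t1 = Suc (Suc (Suc 0))"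
      "y1 \<in> minor_indices m n" "Poly_Mapping.keys t1 \<subseteq> minor_indices m n"
      by (meson mon_degree_Suc subset_iff)
    then obtain y2 t2 where 2: "t1 = Poly_Mapping.single y2 1 + t2" "mon_degree t2 = Suc (Suc 0)"
      "y2 \<in> minor_indices m n" "Poly_Mapping.keys t2 \<subseteq> minor_indices m n"
      by (meson mon_degree_Suc subset_iff)
    then obtain y3 t3 where 3: "t2 = Poly_Mapping.single y3 1 + t3" "mon_degree t3 = Suc 0"
      "y3 \<in> minor_indices m n" "Poly_Mapping.keys t3 \<subseteq> minor_indices m n"
      by (meson mon_degree_Suc subset_iff)
    then obtain y4 t4 where 4: "t3 = Poly_Mapping.single y4 1 + t4" "mon_degree t4 = 0"
      "y4 \<in> minor_indices m n"
      by (meson mon_degree_Suc subset_iff)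
    have "t4 = 0"
      using 4(2) by (intro poly_mapping_eqI) (auto simp: mon_degree_def in_keys_iff)
    then have eq: "Poly_Mapping.single t (1::'a) = Var y1 * Var y2 * Var y3 * Var y4"
      by (simp add: Var_def mult_single 1 2 3 4 add.assoc)
    obtain a b p q where y1: "y1 = ((a, b), (p, q))" by (metis surj_pair)
    obtain c d r s where y2: "y2 = ((c, d), (r, s))" by (metis surj_pair)
    obtain e g u v where y3: "y3 = ((e, g), (u, v))" by (metis surj_pair)
    obtain h k w x where y4: "y4 = ((h, k), (w, x))" by (metis surj_pair)
    define i where "i j = [a, b, c, d, e, g, h, k] ! (j - 1)" for j
    define \<rho> where "\<rho> j = [p, q, r, s, u, v, w, x] ! (j - 1)" for j
    have "Var y1 * Var y2 * Var y3 * Var y4 = (word i \<rho> :: (minor_idx, 'a) mpoly)"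
      using 1(3) 2(3) 3(3) 4(3)
      by (simp add: word_def y1 y2 y3 y4 i_def \<rho>_def bvar_def skew_def minor_indices_def)
    moreover have "(i, \<rho>) \<in> sorted_words m n"
      using 1(3) 2(3) 3(3) 4(3) unfolding sorted_words_def atLeastAtMost_8
      by (simp add: y1 y2 y3 y4 i_def \<rho>_def minor_indices_def)
    ultimately show ?thesis using eq by auto
  qed
  then show ?thesis
    by (subst poly_eq_sum) (intro mpoly.span_sum mpoly.span_scale mpoly.span_base)
qed

text \<open>The sum is the expansion of a product over \<open>B\<close> with factor 1 at each
  element of \<open>R\<close> and factor 1 - 1 = 0 at every other element; \<open>T\<close> collects
  the places where the summand 1 is chosen.\<close>

lemma sum_supersets:
  assumes "finite B" "R \<subseteq> B"
  shows "(\<Sum>T\<in>Pow B. if R \<subseteq> T then (-1) ^ card (B - T) else 0) = (if R = B then 1 else (0::'k::comm_ring_1))"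
proof -
  have "(\<Prod>x\<in>B. 1 + (if x \<in> R then 0 else - 1 :: 'k)) =
      (\<Sum>T\<in>Pow B. (\<Prod>x\<in>T. 1) * (\<Prod>x\<in>B - T. if x \<in> R then 0 else - 1))"
    by (rule prod_add[OF assms(1)])
  also have "\<dots> = (\<Sum>T\<in>Pow B. if R \<subseteq> T then (-1) ^ card (B - T) else 0)"
  proof (rule sum.cong[OF refl])
    fix T assume T: "T \<in> Pow B"
    show "(\<Prod>x\<in>T. 1) * (\<Prod>x\<in>B - T. if x \<in> R then 0 else - 1 :: 'k) =
        (if R \<subseteq> T then (-1) ^ card (B - T) else 0)"
    proof (cases "R \<subseteq> T")
      case True
      then have "(\<Prod>x\<in>B - T. if x \<in> R then 0 else - 1 :: 'k) = (\<Prod>x\<in>B - T. - 1)"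
        by (intro prod.cong) auto
      with True show ?thesis by simp
    next
      case False
      with assms have "\<exists>x\<in>B - T. x \<in> R" by blast
      with False show ?thesis using assms(1) by (auto intro!: prod_zero)
    qed
  qed
  finally have eq: "(\<Sum>T\<in>Pow B. if R \<subseteq> T then (-1) ^ card (B - T) else 0)
      = (\<Prod>x\<in>B. 1 + (if x \<in> R then 0 else - 1 :: 'k))" ..
  show ?thesis
  proof (cases "R = B")
    case True
    then have "(\<Prod>x\<in>B. 1 + (if x \<in> R then 0 else - 1 :: 'k)) = 1"
      by (intro prod.neutral) auto
    with True show ?thesis unfolding eq by simp
  next
    case False
    with assms have "\<exists>x\<in>B. 1 + (if x \<in> R then 0 else - 1 :: 'k) = 0" by auto
    then have "(\<Prod>x\<in>B. 1 + (if x \<in> R then 0 else - 1 :: 'k)) = 0"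
      using assms(1) by (intro prod_zero)
    with False show ?thesis unfolding eq by simp
  qed
qed

section \<open>Polarization of words and restitution\<close>

lemma row_perm_word:
  assumes "\<And>s. s \<in> {1..8} \<Longrightarrow> \<phi> (\<kappa> s) = i s"
  shows "row_perm \<phi> (word \<kappa> \<rho>) = word i \<rho>"
  using assms by (simp add: word_def row_perm_simps)

text \<open>Extensional functions, so that each bijection of \<open>{1..8}\<close> is counted
  exactly once.\<close>

definition row_bijections :: "(nat \<Rightarrow> nat) set" where
  "row_bijections = {\<kappa> \<in> {1..8} \<rightarrow>\<^sub>E {1..8}. \<kappa> ` {1..8} = {1..8}}"

lemma finite_row_bijections: "finite row_bijections"
  unfolding row_bijections_def by (intro finite_subset[OF _ finite_PiE[of "{1..8}" "\<lambda>_. {1..8}"]]) auto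

lemma row_bijections_nonempty: "row_bijections \<noteq> {}"
proof -
  have "(\<lambda>s\<in>{1..8}. s) \<in> row_bijections"
    by (auto simp: row_bijections_def)
  then show ?thesis by blast
qed

lemma row_bijections_inj: "\<kappa> \<in> row_bijections \<Longrightarrow> inj_on \<kappa> {1..8}"
  by (rule eq_card_imp_inj_on) (auto simp: row_bijections_def)

lemma word_multilinear:
  assumes "\<kappa> \<in> row_bijections" "\<rho> ` {1..8} \<subseteq> {1..n}"
  shows "word \<kappa> \<rho> \<in> multilinear n"
proof -
  have "distinct (map \<kappa> [1, 2, 3, 4, 5, 6, 7, 8])"
    using row_bijections_inj[OF assms(1)] unfolding distinct_map atLeastAtMost_8 by simp
  moreover have "{\<kappa> 1, \<kappa> 2, \<kappa> 3, \<kappa> 4, \<kappa> 5, \<kappa> 6, \<kappa> 7, \<kappa> 8} \<subseteq> {1..8}"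
    using assms(1) unfolding row_bijections_def by auto
  ultimately have "bijective_rows (\<kappa> 1) (\<kappa> 2) (\<kappa> 3) (\<kappa> 4) (\<kappa> 5) (\<kappa> 6) (\<kappa> 7) (\<kappa> 8)"
    unfolding bijective_rows_def by (simp only: list.map)
  moreover have "{\<rho> 1, \<rho> 2, \<rho> 3, \<rho> 4, \<rho> 5, \<rho> 6, \<rho> 7, \<rho> 8} \<subseteq> {1..n}"
    using assms(2) unfolding atLeastAtMost_8 by (simp only: image_insert image_empty)
  ultimately show ?thesis
    unfolding multilinear_def word_def by (blast intro: wordsI)
qed

text \<open>
  The part of the polarization of \<open>f\<close> that is multilinear in the new rows \<open>1, \<dots>, 8\<close> when new row \<open>k\<close>
  is a copy of the old row \<open>\<phi> k\<close>, extracted by inclusion-exclusion.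
\<close>

definition polarize :: "(nat \<Rightarrow> nat) \<Rightarrow> (minor_idx, 'k::field) mpoly \<Rightarrow> (minor_idx, 'k) mpoly" where
  "polarize \<phi> f = (\<Sum>T\<in>Pow {1..8}. Const ((-1) ^ card ({1..8} - T)) * row_subst (\<lambda>i. {k \<in> T. \<phi> k = i}) f)"

lemma polarize_linear:
  "polarize \<phi> (f + g) = polarize \<phi> f + polarize \<phi> g"
  "polarize \<phi> (Const c * f) = Const c * polarize \<phi> f"
  "polarize \<phi> 0 = 0"
  by (simp_all add: polarize_def row_subst_simps distrib_left sum.distrib sum_distrib_left mult.left_commute)

lemma polarize_J2:
  assumes "f \<in> J2 m n"
  shows "polarize \<phi> f \<in> J2 8 n"
  unfolding polarize_def
  by (intro mpoly.subspace_sum[OF subspace_J2] mpoly.subspace_scale[OF subspace_J2] row_subst_J2[OF _ assms]) auto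

text \<open>Expanding the substituted rows chooses, for each slot, a new row in \<open>T\<close>
  that copies the old one. The alternating sum over \<open>T\<close> retains the choices whose range
  is all of \<open>{1..8}\<close>, which are the bijections.\<close>

lemma polarize_word:
  assumes "(i, \<rho>) \<in> sorted_words m n"
  shows "polarize \<phi> (word i \<rho> :: (minor_idx, 'k::field) mpoly)
    = (\<Sum>\<kappa>\<in>{\<kappa> \<in> row_bijections. \<forall>s\<in>{1..8}. \<phi> (\<kappa> s) = i s}. word \<kappa> \<rho>)"
proof -
  define B where "B = {1..8::nat}"
  define K where "K = Pi\<^sub>E B (\<lambda>s. {k \<in> B. \<phi> k = i s})"
  have finB: "finite B" and finK: "finite K" by (auto simp: B_def K_def intro!: finite_PiE)
  have "row_subst (\<lambda>i. {k \<in> T. \<phi> k = i}) (word i \<rho> :: (minor_idx, 'k) mpoly)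
      = (\<Sum>\<kappa>\<in>K. if \<kappa> ` B \<subseteq> T then word \<kappa> \<rho> else 0)" if T: "T \<subseteq> B" for T
  proof -
    have "Pi\<^sub>E B (\<lambda>s. {k \<in> T. \<phi> k = i s}) = {\<kappa> \<in> K. \<kappa> ` B \<subseteq> T}"
      using T by (auto simp: K_def PiE_iff extensional_def)
    then show ?thesis
      by (simp only: row_subst_word[OF assms] B_def[symmetric] sum.inter_filter[OF finK])
  qed
  then have "polarize \<phi> (word i \<rho> :: (minor_idx, 'k) mpoly) = (\<Sum>T\<in>Pow B. \<Sum>\<kappa>\<in>K.
      Const ((-1) ^ card (B - T)) * (if \<kappa> ` B \<subseteq> T then word \<kappa> \<rho> else 0))"
    unfolding polarize_def B_def[symmetric] by (simp add: sum_distrib_left)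
  also have "\<dots> = (\<Sum>\<kappa>\<in>K. \<Sum>T\<in>Pow B. Const ((-1) ^ card (B - T)) * (if \<kappa> ` B \<subseteq> T then word \<kappa> \<rho> else 0))"
    by (rule sum.swap)
  also have "\<dots> = (\<Sum>\<kappa>\<in>K. if \<kappa> ` B = B then word \<kappa> \<rho> else 0)"
  proof (rule sum.cong[OF refl])
    fix \<kappa> assume \<kappa>: "\<kappa> \<in> K"
    have C: "Const (\<Sum>T\<in>F. w T) = (\<Sum>T\<in>F. Const (w T) :: (minor_idx, 'k) mpoly)" for F :: "nat set set" and w
      by (induction F rule: infinite_finite_induct) (simp_all add: Const_add)
    have "(\<Sum>T\<in>Pow B. Const ((-1) ^ card (B - T)) * (if \<kappa> ` B \<subseteq> T then word \<kappa> \<rho> else 0 :: (minor_idx, 'k) mpoly))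
      = (\<Sum>T\<in>Pow B. Const (if \<kappa> ` B \<subseteq> T then (-1) ^ card (B - T) else 0) * word \<kappa> \<rho>)"
      by (intro sum.cong) auto
    also have "\<dots> = Const (\<Sum>T\<in>Pow B. if \<kappa> ` B \<subseteq> T then (-1) ^ card (B - T) else 0) * word \<kappa> \<rho>"
      by (simp only: C sum_distrib_right)
    also have "\<dots> = Const (if \<kappa> ` B = B then 1 else 0) * word \<kappa> \<rho>"
      by (subst sum_supersets) (use \<kappa> finB in \<open>auto simp: K_def PiE_iff\<close>)
    finally show "(\<Sum>T\<in>Pow B. Const ((-1) ^ card (B - T)) * (if \<kappa> ` B \<subseteq> T then word \<kappa> \<rho> else 0))
      = (if \<kappa> ` B = B then word \<kappa> \<rho> else 0 :: (minor_idx, 'k) mpoly)"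
      by simp
  qed
  also have "\<dots> = (\<Sum>\<kappa>\<in>{\<kappa> \<in> K. \<kappa> ` B = B}. word \<kappa> \<rho>)"
    using finK by (simp add: sum.inter_filter)
  also have "{\<kappa> \<in> K. \<kappa> ` B = B} = {\<kappa> \<in> row_bijections. \<forall>s\<in>{1..8}. \<phi> (\<kappa> s) = i s}"
    unfolding row_bijections_def K_def B_def by (auto simp: PiE_iff)
  finally show ?thesis .
qed

text \<open>Merging the copies turns every term of the polarization back into the word itself. A
  bijection \<kappa> occurs for exactly one \<phi>, namely \<open>i\<close> composed with the
  inverse of \<kappa>, so the word is counted once for each bijection.\<close>

lemma restitute_word:
  assumes i: "(i, \<rho>) \<in> sorted_words m n"
  shows "(\<Sum>\<phi>\<in>{1..8} \<rightarrow>\<^sub>E {1..m}. row_perm \<phi> (polarize \<phi> (word i \<rho> :: (minor_idx, 'k::field) mpoly)))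
    = Const (of_nat (card row_bijections)) * word i \<rho>"
proof -
  let ?\<Phi> = "{1..8::nat} \<rightarrow>\<^sub>E {1..m}"
  let ?R = "\<lambda>\<phi> \<kappa>. \<forall>s\<in>{1..8}. \<phi> (\<kappa> s) = i s"
  have fin: "finite ?\<Phi>" by (intro finite_PiE) auto
  have "(\<Sum>\<phi>\<in>?\<Phi>. row_perm \<phi> (polarize \<phi> (word i \<rho>)))
      = (\<Sum>\<phi>\<in>?\<Phi>. \<Sum>\<kappa>\<in>{\<kappa> \<in> row_bijections. ?R \<phi> \<kappa>}. word i \<rho> :: (minor_idx, 'k) mpoly)"
    unfolding polarize_word[OF i] row_perm_hom
    by (intro sum.cong refl row_perm_word) auto
  also have "\<dots> = (\<Sum>\<phi>\<in>?\<Phi>. \<Sum>\<kappa>\<in>row_bijections. if ?R \<phi> \<kappa> then word i \<rho> else 0)"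
    by (simp only: sum.inter_filter[OF finite_row_bijections])
  also have "\<dots> = (\<Sum>\<kappa>\<in>row_bijections. \<Sum>\<phi>\<in>?\<Phi>. if ?R \<phi> \<kappa> then word i \<rho> else 0)"
    by (rule sum.swap)
  also have "\<dots> = (\<Sum>\<kappa>\<in>row_bijections. \<Sum>\<phi>\<in>{\<phi> \<in> ?\<Phi>. ?R \<phi> \<kappa>}. word i \<rho>)"
    by (simp only: sum.inter_filter[OF fin])
  also have "\<dots> = (\<Sum>\<kappa>\<in>row_bijections. word i \<rho>)"
  proof (rule sum.cong[OF refl])
    fix \<kappa> assume \<kappa>: "\<kappa> \<in> row_bijections"
    define \<psi> where "\<psi> = (\<lambda>k\<in>{1..8}. i (inv_into {1..8} \<kappa> k))"
    have im: "\<kappa> ` {1..8} = {1..8}" using \<kappa> by (simp add: row_bijections_def)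
    have "i ` {1..8} \<subseteq> {1..m}" using i by (simp add: sorted_words_def)
    moreover have "inv_into {1..8} \<kappa> k \<in> {1..8}" if "k \<in> {1..8}" for k
      using that im by (metis inv_into_into)
    ultimately have "\<psi> \<in> ?\<Phi>" by (auto simp: \<psi>_def simp del: atLeastAtMost_iff)
    moreover have "?R \<psi> \<kappa>"
    proof
      fix s :: nat assume s: "s \<in> {1..8}"
      then have "\<kappa> s \<in> {1..8}" using im by blast
      then show "\<psi> (\<kappa> s) = i s"
        using s row_bijections_inj[OF \<kappa>] by (simp add: \<psi>_def inv_into_f_f del: atLeastAtMost_iff)
    qed
    moreover have "\<phi> = \<psi>" if "\<phi> \<in> ?\<Phi>" "?R \<phi> \<kappa>" for \<phi>
    proof (rule PiE_ext[OF that(1) \<open>\<psi> \<in> ?\<Phi>\<close>])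
      fix k :: nat assume "k \<in> {1..8}"
      then obtain s where "s \<in> {1..8}" "k = \<kappa> s" using im by blast
      then show "\<phi> k = \<psi> k" using that(2) \<open>?R \<psi> \<kappa>\<close> by simp
    qed
    ultimately have "{\<phi> \<in> ?\<Phi>. ?R \<phi> \<kappa>} = {\<psi>}" by blast
    then show "(\<Sum>\<phi>\<in>{\<phi> \<in> ?\<Phi>. ?R \<phi> \<kappa>}. word i \<rho>) = (word i \<rho> :: (minor_idx, 'k) mpoly)"
      by simp
  qed
  finally show ?thesis by (simp flip: of_nat_Const)
qed

lemma polarize_multilinear:
  assumes "f \<in> mpoly.span {word i \<rho> | i \<rho>. (i, \<rho>) \<in> sorted_words m n}"
  shows "polarize \<phi> f \<in> mpoly.span (multilinear n)"
  using assms
proof (induction rule: mpoly.span_induct)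
  case base
  show ?case
    by (auto simp: mpoly.subspace_def polarize_linear mpoly.span_zero mpoly.span_add mpoly.span_scale)
next
  case (step x)
  then obtain i \<rho> where x: "x = word i \<rho>" and i: "(i, \<rho>) \<in> sorted_words m n" by blast
  have "\<rho> ` {1..8} \<subseteq> {1..n}" using i by (simp add: sorted_words_def)
  then show ?case
    unfolding x polarize_word[OF i]
    by (intro mpoly.span_sum mpoly.span_base word_multilinear) auto
qed

lemma restitute:
  assumes "f \<in> mpoly.span {word i \<rho> | i \<rho>. (i, \<rho>) \<in> sorted_words m n}"
  shows "(\<Sum>\<phi>\<in>{1..8} \<rightarrow>\<^sub>E {1..m}. row_perm \<phi> (polarize \<phi> f)) = Const (of_nat (card row_bijections)) * f"
  using assms
proof (induction rule: mpoly.span_induct)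
  case base
  show ?case
    unfolding mpoly.subspace_def
    by (simp add: polarize_linear row_perm_hom sum.distrib distrib_left mult.left_commute
        flip: sum_distrib_left)
next
  case (step x)
  then show ?case using restitute_word by blast
qed

theorem mainTheorem6:
  fixes m n :: nat
  assumes "2 \<le> m" and "m \<le> n"
  shows "(J2 m n \<inter> homogeneous 4 :: (minor_idx, 'k::field_char_0) mpoly set) =
           (S2 m n \<inter> homogeneous 1) \<cdot> (J2 m n \<inter> homogeneous 3)"
proof
  show "(S2 m n \<inter> homogeneous 1) \<cdot> (J2 m n \<inter> homogeneous 3) \<subseteq>
      (J2 m n \<inter> homogeneous 4 :: (minor_idx, 'k) mpoly set)"
    using decomposable_subset unfolding decomposable_def .
  show "(J2 m n \<inter> homogeneous 4 :: (minor_idx, 'k) mpoly set) \<subseteq>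
      (S2 m n \<inter> homogeneous 1) \<cdot> (J2 m n \<inter> homogeneous 3)"
  proof
    fix f :: "(minor_idx, 'k) mpoly" assume f: "f \<in> J2 m n \<inter> homogeneous 4"
    then have span: "f \<in> mpoly.span {word i \<rho> | i \<rho>. (i, \<rho>) \<in> sorted_words m n}"
      by (intro homogeneous_4_span) (auto simp: J2_def)
    \<comment> \<open>The polarization is a multilinear relation in eight rows, hence decomposable
      there; merging rows along \<phi> preserves this. Summed over all \<phi>, these pieces give a
      nonzero multiple of \<open>f\<close>.\<close>
    have "row_perm \<phi> (polarize \<phi> f) \<in> decomposable m n" if "\<phi> \<in> {1..8} \<rightarrow>\<^sub>E {1..m}" for \<phi>
      unfolding row_perm_def
    proof (rule row_subst_decomposable)
      show "polarize \<phi> f \<in> decomposable 8 n"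
        using f by (intro multilinear_decomposable polarize_multilinear[OF span] polarize_J2) auto
    qed (use that in auto)
    then have "Const (of_nat (card row_bijections)) * f \<in> decomposable m n"
      unfolding restitute[OF span, symmetric] by (intro mpoly.subspace_sum[OF subspace_decomposable])
    then have "f \<in> decomposable m n"
      by (rule Const_mult_cancel[OF subspace_decomposable])
        (simp add: finite_row_bijections row_bijections_nonempty)
    then show "f \<in> (S2 m n \<inter> homogeneous 1) \<cdot> (J2 m n \<inter> homogeneous 3)"
      by (simp only: decomposable_def)
  qed
qed

end
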